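(* Let $U$ be a unital complex associative algebra, $\theta\in\mathrm{Aut}(U)$ an involutive unital algebra automorphism with $(\pm1)$-eigenspaces $U^{\pm}$, and $\mathfrak{a}\subseteq U^-$ a finite dimensional linear subspace. Let $r:\mathfrak{a}^*\to U^{\otimes 2}$ be a meromorphic function that is $\theta$-twisted symmetric, i.e. $\widetilde r:=(\theta\otimes\mathrm{id})r$ satisfies $\widetilde r_{21}=\widetilde r$. Set $r^{\pm}:=\frac12(\widetilde r\pm r):\mathfrak{a}^*\to U^{\pm}\otimes U$. The following statements are equivalent. (1) $r$ is a classical dynamical $r$-matrix, i.e. $\mathrm{YB}(r)=0$. (2) $(r^+,r^-)$ is a classical dynamical $r$-matrix pair, i.e. $\mathrm{CYB}[t](r^+,r^-)=0$ for $t=1,2,3$, and it satisfies the additional non-dynamical equation $\mathrm{CYB}(r^+,r^-)=0$.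
   Context: All tensor products are over $\mathbb{C}$. $\mathcal{M}$ is the field of meromorphic functions on $\mathfrak{a}^*$; for a complex algebra $B$, a meromorphic function $\mathfrak{a}^*\to B$ means an element of the algebraic tensor product $\mathcal{M}\otimes B$ (an algebra; linear maps between such $B$'s are applied pointwise). If $z\in U^{\otimes k}$ and $i_1,\dots,i_k\in\{1,\dots,N\}$ are distinct, $z_{i_1\cdots i_k}\in U^{\otimes N}$ has the $j$-th tensor component of $z$ in position $i_j$ and $1$ elsewhere (so $\widetilde r_{21}$ is the flip of $\widetilde r$). Let $\{x_k\}_{k=1}^d$ be a basis of $\mathfrak{a}$ with dual basis $\{\lambda_k\}$ of $\mathfrak{a}^*$, $\partial_\lambda$ the directional derivative in direction $\lambda\in\mathfrak{a}^*$, and for a $U^{\otimes N}$-valued meromorphic $f$ put $E_i(f):=\sum_{k=1}^d (x_k)_i\,\partial_{\lambda_k}(f)$ (basis independent). For meromorphic $r,r^{\pm}:\mathfrak{a}^*\to U^{\otimes 2}$ define $U^{\otimes 3}$-valued functions $$\mathrm{YB}(r):=[r_{12},r_{13}]+[r_{12},r_{23}]+[r_{13},r_{23}]+E_1(r_{23})-E_2(r_{13})+E_3(r_{12}),$$ $$\mathrm{CYB}[1](r^+,r^-):=[r_{12}^+,r_{13}^+]+[r_{12}^+,r_{23}^+]-[r_{13}^+,r_{23}^-]+E_3(r_{12}^+)-E_2(r_{13}^+),$$ $$\mathrm{CYB}[2](r^+,r^-):=[r_{12}^-,r_{13}^+]+[r_{12}^-,r_{23}^+]+[r_{13}^-,r_{23}^+]+E_3(r_{12}^-)-E_1(r_{23}^+),$$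 $$\mathrm{CYB}[3](r^+,r^-):=-[r_{12}^+,r_{13}^-]+[r_{12}^-,r_{23}^-]+[r_{13}^-,r_{23}^-]+E_2(r_{13}^-)-E_1(r_{23}^-),$$ $$\mathrm{CYB}(r^+,r^-):=[r_{12}^-,r_{13}^-]-[r_{12}^+,r_{23}^-]+[r_{13}^+,r_{23}^+].$$ *)

theory Defs
  imports "HOL-Complex_Analysis.Complex_Analysis" "HOL-Library.Poly_Mapping" "HOL-Library.Numeral_Type"
begin

section \<open>Complex vector spaces and unital associative complex algebras\<close>

class complex_vector = ab_group_add +
  fixes scaleC :: "complex \<Rightarrow> 'a \<Rightarrow> 'a" (infixr \<open>*\<^sub>C\<close> 75)
  assumes scaleC_add_right: "c *\<^sub>C (x + y) = c *\<^sub>C x + c *\<^sub>C y"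
    and scaleC_add_left: "(c + d) *\<^sub>C x = c *\<^sub>C x + d *\<^sub>C x"
    and scaleC_scaleC: "c *\<^sub>C d *\<^sub>C x = (c * d) *\<^sub>C x"
    and scaleC_one: "1 *\<^sub>C x = x"

(* Sorts ring and monoid_mult instead of ring_1, so that the zero algebra is included. *)
class complex_algebra_1 = complex_vector + ring + monoid_mult +
  assumes mult_scaleC_left: "(c *\<^sub>C x) * y = c *\<^sub>C (x * y)"
    and mult_scaleC_right: "x * (c *\<^sub>C y) = c *\<^sub>C (x * y)"

global_interpretation cvec: vector_space "scaleC :: complex \<Rightarrow> 'a \<Rightarrow> 'a::complex_vector"
  by unfold_locales (simp_all add: scaleC_add_right scaleC_add_left scaleC_scaleC scaleC_one)

abbreviation clinear :: "('a::complex_vector \<Rightarrow> 'b::complex_vector) \<Rightarrow> bool"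
  where "clinear \<equiv> Vector_Spaces.linear scaleC scaleC"

lemma clinear_iff:
  "clinear f \<longleftrightarrow> (\<forall>x y. f (x + y) = f x + f y) \<and> (\<forall>c x. f (c *\<^sub>C x) = c *\<^sub>C f x)"
  by (auto simp: Vector_Spaces.linear_def module_hom_def module_hom_axioms_def
      cvec.vector_space_axioms cvec.module_axioms)

lemma clinear_zero: "clinear f \<Longrightarrow> f 0 = 0"
  by (auto simp: clinear_iff) (metis add_cancel_right_right)

lemma clinear_minus: "clinear f \<Longrightarrow> f (- x) = - f x"
  by (metis clinear_iff cvec.scale_minus_left scaleC_one)

lemma clinear_diff: "clinear f \<Longrightarrow> f (x - y) = f x - f y"
  by (metis clinear_iff clinear_minus diff_conv_add_uminus)

lemma clinear_sum: "clinear f \<Longrightarrow> f (sum g A) = (\<Sum>a\<in>A. f (g a))"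
  by (induction A rule: infinite_finite_induct) (auto simp: clinear_zero clinear_iff)

instantiation complex :: complex_algebra_1
begin
definition scaleC_complex :: "complex \<Rightarrow> complex \<Rightarrow> complex"
  where "scaleC_complex c x = c * x"
instance by standard (simp_all add: scaleC_complex_def algebra_simps)
end

instantiation poly_mapping :: (type, complex_vector) complex_vector
begin
lift_definition scaleC_poly_mapping :: "complex \<Rightarrow> ('a \<Rightarrow>\<^sub>0 'b) \<Rightarrow> ('a \<Rightarrow>\<^sub>0 'b)"
  is "\<lambda>c f k. c *\<^sub>C f k"
  by (erule rev_finite_subset) auto
instance
  by standard (transfer, simp add: fun_eq_iff scaleC_add_right scaleC_add_left scaleC_scaleC scaleC_one)+
end

lemma lookup_scaleC [simp]: "Poly_Mapping.lookup (c *\<^sub>C p) k = c *\<^sub>C Poly_Mapping.lookup p k"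
  by transfer simp


section \<open>Linear extension from the free complex vector space\<close>

definition free_lift :: "('k \<Rightarrow> 'c::complex_vector) \<Rightarrow> ('k \<Rightarrow>\<^sub>0 complex) \<Rightarrow> 'c"
  where "free_lift f p = (\<Sum>k\<in>Poly_Mapping.keys p. Poly_Mapping.lookup p k *\<^sub>C f k)"

lemma free_lift_superset:
  assumes "finite S" "Poly_Mapping.keys p \<subseteq> S"
  shows "free_lift f p = (\<Sum>k\<in>S. Poly_Mapping.lookup p k *\<^sub>C f k)"
  unfolding free_lift_def
  by (rule sum.mono_neutral_left) (use assms in \<open>auto simp: in_keys_iff\<close>)

lemma clinear_free_lift: "clinear (free_lift f)"
proof -
  have "free_lift f (p + q) = free_lift f p + free_lift f q" for p q
  proof -
    let ?S = "Poly_Mapping.keys p \<union> Poly_Mapping.keys q"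
    have "Poly_Mapping.keys (p + q) \<subseteq> ?S" by (rule Poly_Mapping.keys_add)
    then show ?thesis
      by (simp add: free_lift_superset[of ?S] lookup_add scaleC_add_left sum.distrib)
  qed
  moreover have "free_lift f (c *\<^sub>C p) = c *\<^sub>C free_lift f p" for c p
  proof -
    have "Poly_Mapping.keys (c *\<^sub>C p) \<subseteq> Poly_Mapping.keys p"
      by (auto simp: in_keys_iff scaleC_complex_def)
    then show ?thesis
      by (simp add: free_lift_superset[of "Poly_Mapping.keys p"] cvec.scale_sum_right scaleC_complex_def
          scaleC_scaleC)
  qed
  ultimately show ?thesis by (simp add: clinear_iff)
qed

lemma free_lift_single [simp]: "free_lift f (Poly_Mapping.single k c) = c *\<^sub>C f k"
  by (simp add: free_lift_def)

lemma free_ext: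
  assumes "clinear F" "clinear G"
    and "\<And>k. F (Poly_Mapping.single k 1) = G (Poly_Mapping.single k 1)"
  shows "F p = G (p :: 'k \<Rightarrow>\<^sub>0 complex)"
proof -
  have p: "p = (\<Sum>k\<in>Poly_Mapping.keys p. Poly_Mapping.lookup p k *\<^sub>C Poly_Mapping.single k 1)"
    by (rule poly_mapping_eqI)
       (auto simp: lookup_sum scaleC_complex_def lookup_single "when_def" in_keys_iff if_distrib
         sum.If_cases sum.delta cong: if_cong)
  have "F p = (\<Sum>k\<in>Poly_Mapping.keys p. Poly_Mapping.lookup p k *\<^sub>C F (Poly_Mapping.single k 1))"
    using assms(1)[unfolded clinear_iff] by (subst p) (simp only: clinear_sum[OF assms(1)])
  also have "\<dots> = G p"
    using assms(2)[unfolded clinear_iff]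
    by (subst (3) p) (simp only: clinear_sum[OF assms(2)] assms(3))
  finally show ?thesis .
qed

lemma clinear_vanish_span:
  assumes "clinear F" "\<And>x. x \<in> R \<Longrightarrow> F x = 0" "x \<in> cvec.span R"
  shows "F x = 0"
  using assms(3)
  by (induction rule: cvec.span_induct_alt)
     (use assms in \<open>auto simp: clinear_zero clinear_iff\<close>)


section \<open>The tensor product of two complex vector spaces\<close>

definition tensor_rels :: "(('a::complex_vector \<times> 'b::complex_vector) \<Rightarrow>\<^sub>0 complex) set" where
  "tensor_rels =
     {Poly_Mapping.single (x + x', y) 1 - Poly_Mapping.single (x, y) 1 - Poly_Mapping.single (x', y) 1 | x x' y. True}
   \<union> {Poly_Mapping.single (x, y + y') 1 - Poly_Mapping.single (x, y) 1 - Poly_Mapping.single (x, y') 1 | x y y'. True}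
   \<union> {Poly_Mapping.single (c *\<^sub>C x, y) 1 - c *\<^sub>C Poly_Mapping.single (x, y) 1 | c x y. True}
   \<union> {Poly_Mapping.single (x, c *\<^sub>C y) 1 - c *\<^sub>C Poly_Mapping.single (x, y) 1 | c x y. True}"

definition tensor_rel ::
    "(('a::complex_vector \<times> 'b::complex_vector) \<Rightarrow>\<^sub>0 complex) \<Rightarrow> ('a \<times> 'b \<Rightarrow>\<^sub>0 complex) \<Rightarrow> bool"
  where "tensor_rel p q \<longleftrightarrow> p - q \<in> cvec.span tensor_rels"

lemma span_equivp: "equivp (\<lambda>p q. p - q \<in> cvec.span R)"
proof (rule equivpI)
  show "reflp (\<lambda>p q. p - q \<in> cvec.span R)" by (simp add: reflp_def cvec.span_zero)
  show "symp (\<lambda>p q. p - q \<in> cvec.span R)"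
    by (rule sympI) (metis cvec.span_neg minus_diff_eq)
  show "transp (\<lambda>p q. p - q \<in> cvec.span R)"
    by (rule transpI) (metis cvec.span_add diff_add_cancel add_diff_eq)
qed

quotient_type (overloaded) ('a, 'b) tensor = "('a::complex_vector \<times> 'b::complex_vector) \<Rightarrow>\<^sub>0 complex" / tensor_rel
  unfolding tensor_rel_def by (rule span_equivp)

lemma span_respects:
  assumes "p - q \<in> cvec.span R" "p' - q' \<in> cvec.span R"
  shows "(p + p') - (q + q') \<in> cvec.span R" "(p - p') - (q - q') \<in> cvec.span R"
    "(- p) - (- q) \<in> cvec.span R" "c *\<^sub>C p - c *\<^sub>C q \<in> cvec.span R"
proof -
  show "(p + p') - (q + q') \<in> cvec.span R"
    using cvec.span_add[OF assms] by (simp add: algebra_simps)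
  show "(p - p') - (q - q') \<in> cvec.span R"
    using cvec.span_diff[OF assms] by (simp add: algebra_simps)
  show "(- p) - (- q) \<in> cvec.span R"
    using cvec.span_neg[OF assms(1)] by (simp add: algebra_simps)
  show "c *\<^sub>C p - c *\<^sub>C q \<in> cvec.span R"
    using cvec.span_scale[OF assms(1), of c] by (simp add: cvec.scale_right_diff_distrib)
qed

lemma tensor_rel_refl: "p = q \<Longrightarrow> tensor_rel p q"
  by (simp add: tensor_rel_def cvec.span_zero)

instantiation tensor :: (complex_vector, complex_vector) complex_vector
begin
lift_definition zero_tensor :: "('a, 'b) tensor" is 0 .
lift_definition plus_tensor :: "('a, 'b) tensor \<Rightarrow> ('a, 'b) tensor \<Rightarrow> ('a, 'b) tensor"
  is "(+)" unfolding tensor_rel_def by (rule span_respects)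
lift_definition minus_tensor :: "('a, 'b) tensor \<Rightarrow> ('a, 'b) tensor \<Rightarrow> ('a, 'b) tensor"
  is "(-)" unfolding tensor_rel_def by (rule span_respects)
lift_definition uminus_tensor :: "('a, 'b) tensor \<Rightarrow> ('a, 'b) tensor"
  is uminus unfolding tensor_rel_def by (rule span_respects)
lift_definition scaleC_tensor :: "complex \<Rightarrow> ('a, 'b) tensor \<Rightarrow> ('a, 'b) tensor"
  is scaleC unfolding tensor_rel_def by (rule span_respects)
instance
  by standard (transfer, rule tensor_rel_refl,
      simp add: algebra_simps scaleC_add_right scaleC_add_left scaleC_scaleC scaleC_one)+
end

lift_definition pure_tensor :: "'a::complex_vector \<Rightarrow> 'b::complex_vector \<Rightarrow> ('a, 'b) tensor"
    (infixr \<open>\<otimes>\<^sub>C\<close> 72)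
  is "\<lambda>x y. Poly_Mapping.single (x, y) 1" .

definition cbilinear :: "('a::complex_vector \<Rightarrow> 'b::complex_vector \<Rightarrow> 'c::complex_vector) \<Rightarrow> bool"
  where "cbilinear f \<longleftrightarrow> (\<forall>y. clinear (\<lambda>x. f x y)) \<and> (\<forall>x. clinear (f x))"

(* The linear map induced by a bilinear map f; the value does not depend on the representative
   chosen by rep_tensor when f is bilinear, see tensor_lift_abs. *)
definition tensor_lift ::
    "('a::complex_vector \<Rightarrow> 'b::complex_vector \<Rightarrow> 'c::complex_vector) \<Rightarrow> ('a, 'b) tensor \<Rightarrow> 'c"
  where "tensor_lift f t = free_lift (case_prod f) (rep_tensor t)"

lemma tensor_lift_abs:
  assumes "cbilinear f"
  shows "tensor_lift f (abs_tensor p) = free_lift (case_prod f) p"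
proof -
  have "tensor_rel (rep_tensor (abs_tensor p)) p"
    by (meson Quotient3_rep_abs Quotient3_tensor tensor_rel_refl)
  then have *: "rep_tensor (abs_tensor p) - p \<in> cvec.span tensor_rels"
    by (simp add: tensor_rel_def)
  have "free_lift (case_prod f) (rep_tensor (abs_tensor p) - p) = 0"
    by (rule clinear_vanish_span[OF clinear_free_lift _ *])
       (use assms in \<open>auto simp: tensor_rels_def cbilinear_def clinear_diff[OF clinear_free_lift]
          clinear_iff clinear_free_lift[unfolded clinear_iff] scaleC_one\<close>)
  then show ?thesis by (simp add: tensor_lift_def clinear_diff[OF clinear_free_lift])
qed

lemma tensor_lift_pure [simp]: "cbilinear f \<Longrightarrow> tensor_lift f (x \<otimes>\<^sub>C y) = f x y"
  by (simp add: pure_tensor.abs_eq tensor_lift_abs scaleC_one)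

lemma clinear_abs_tensor: "clinear abs_tensor"
  by (simp add: clinear_iff plus_tensor.abs_eq scaleC_tensor.abs_eq)

lemma clinear_tensor_lift:
  assumes "cbilinear f"
  shows "clinear (tensor_lift f)"
proof -
  have "tensor_lift f (s + t) = tensor_lift f s + tensor_lift f t" for s t
    by (induct s, induct t)
       (simp add: plus_tensor.abs_eq tensor_lift_abs[OF assms] clinear_free_lift[unfolded clinear_iff])
  moreover have "tensor_lift f (c *\<^sub>C t) = c *\<^sub>C tensor_lift f t" for c t
    by (induct t)
       (simp add: scaleC_tensor.abs_eq tensor_lift_abs[OF assms] clinear_free_lift[unfolded clinear_iff])
  ultimately show ?thesis by (simp add: clinear_iff)
qed

lemma clinear_compose: "clinear f \<Longrightarrow> clinear g \<Longrightarrow> clinear (\<lambda>x. g (f x))"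
  by (simp add: clinear_iff)

lemma clinear_add: "clinear f \<Longrightarrow> clinear g \<Longrightarrow> clinear (\<lambda>x. f x + g x)"
  by (simp add: clinear_iff scaleC_add_right algebra_simps)

lemma clinear_scale: "clinear f \<Longrightarrow> clinear (\<lambda>x. c *\<^sub>C f x)"
  by (simp add: clinear_iff scaleC_add_right scaleC_scaleC mult.commute)

lemma tensor_ext:
  assumes "clinear F" "clinear G" "\<And>x y. F (x \<otimes>\<^sub>C y) = G (x \<otimes>\<^sub>C y)"
  shows "F t = G t"
proof (induct t rule: tensor.abs_induct)
  fix p
  show "F (abs_tensor p) = G (abs_tensor p)"
    by (rule free_ext[of "\<lambda>p. F (abs_tensor p)" "\<lambda>p. G (abs_tensor p)"])
       (use assms in \<open>auto intro: clinear_compose[OF clinear_abs_tensor] simp: pure_tensor.abs_eq\<close>)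
qed

lemma tensor_rels_intros:
  "Poly_Mapping.single (x + x', y) 1 - (Poly_Mapping.single (x, y) 1 + Poly_Mapping.single (x', y) 1) \<in> tensor_rels"
  "Poly_Mapping.single (x, y + y') 1 - (Poly_Mapping.single (x, y) 1 + Poly_Mapping.single (x, y') 1) \<in> tensor_rels"
  "Poly_Mapping.single (c *\<^sub>C x, y) 1 - c *\<^sub>C Poly_Mapping.single (x, y) 1 \<in> tensor_rels"
  "Poly_Mapping.single (x, c *\<^sub>C y) 1 - c *\<^sub>C Poly_Mapping.single (x, y) 1 \<in> tensor_rels"
  unfolding tensor_rels_def diff_diff_add[symmetric] by blast+

lemma cbilinear_pure_tensor: "cbilinear (\<otimes>\<^sub>C)"
proof -
  have *: "abs_tensor p = abs_tensor q" if "p - q \<in> tensor_rels" for p q :: "('a \<times> 'b) \<Rightarrow>\<^sub>0 complex"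
    using that by (simp add: tensor.abs_eq_iff tensor_rel_def cvec.span_base)
  show ?thesis
    unfolding cbilinear_def clinear_iff pure_tensor.abs_eq plus_tensor.abs_eq scaleC_tensor.abs_eq
    by (intro conjI allI; rule *) (rule tensor_rels_intros)+
qed

lemmas clinear_pure_tensor = cbilinear_pure_tensor[unfolded cbilinear_def]

(* (a \<otimes> b) * (c \<otimes> d) = ac \<otimes> bd, see mult_pure_tensor. *)
definition tensor_mult ::
    "('a::complex_algebra_1, 'b::complex_algebra_1) tensor \<Rightarrow> ('a, 'b) tensor \<Rightarrow> ('a, 'b) tensor"
  where "tensor_mult s t = tensor_lift (\<lambda>a b. tensor_lift (\<lambda>c d. (a * c) \<otimes>\<^sub>C (b * d)) t) s"

lemma clinear_mult_left: "clinear (\<lambda>x. x * (y::'a::complex_algebra_1))"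
  and clinear_mult_right: "clinear (\<lambda>x. (y::'a::complex_algebra_1) * x)"
  by (simp_all add: clinear_iff distrib_left distrib_right mult_scaleC_left mult_scaleC_right)

lemma tensor_mult_inner:
  "cbilinear (\<lambda>c d. (a * c) \<otimes>\<^sub>C (b * d :: 'b::complex_algebra_1) :: ('a::complex_algebra_1, 'b) tensor)"
  using clinear_pure_tensor
  by (auto simp: cbilinear_def intro: clinear_compose[OF clinear_mult_right])

lemma tensor_mult_outer:
  "cbilinear (\<lambda>a b. tensor_lift (\<lambda>c d. (a * c) \<otimes>\<^sub>C (b * d)) t :: ('a::complex_algebra_1, 'b::complex_algebra_1) tensor)"
proof -
  note pur = clinear_pure_tensor[unfolded clinear_iff]
  define L :: "'a \<Rightarrow> 'b \<Rightarrow> ('a, 'b) tensor \<Rightarrow> ('a, 'b) tensor"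
    where "L a b = tensor_lift (\<lambda>c d. (a * c) \<otimes>\<^sub>C (b * d))" for a b
  have lin: "clinear (L a b)" for a b
    unfolding L_def by (rule clinear_tensor_lift[OF tensor_mult_inner])
  have L: "L a b (c \<otimes>\<^sub>C d) = (a * c) \<otimes>\<^sub>C (b * d)" for a b c d
    unfolding L_def by (rule tensor_lift_pure[OF tensor_mult_inner])
  have "L (x + x') b t = L x b t + L x' b t" for x x' b
    by (rule tensor_ext[of "L (x + x') b"])
       (simp_all add: lin L distrib_right pur clinear_add)
  moreover have "L x (b + b') t = L x b t + L x b' t" for x b b'
    by (rule tensor_ext[of "L x (b + b')"])
       (simp_all add: lin L distrib_right pur clinear_add)
  moreover have "L (e *\<^sub>C x) b t = e *\<^sub>C L x b t" for e x b
    by (rule tensor_ext[of "L (e *\<^sub>C x) b"])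
       (simp_all add: lin L mult_scaleC_left pur clinear_scale)
  moreover have "L x (e *\<^sub>C b) t = e *\<^sub>C L x b t" for e x b
    by (rule tensor_ext[of "L x (e *\<^sub>C b)"])
       (simp_all add: lin L mult_scaleC_left pur clinear_scale)
  ultimately have "cbilinear (\<lambda>a b. L a b t)" by (simp add: cbilinear_def clinear_iff)
  then show ?thesis by (simp add: L_def)
qed

lemma tensor_mult_pure: "tensor_mult (a \<otimes>\<^sub>C b) (c \<otimes>\<^sub>C d) = (a * c) \<otimes>\<^sub>C (b * d)"
  unfolding tensor_mult_def
  by (subst tensor_lift_pure[OF tensor_mult_outer]) (rule tensor_lift_pure[OF tensor_mult_inner])

lemma clinear_tensor_mult:
  fixes s t :: "('a::complex_algebra_1, 'b::complex_algebra_1) tensor"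
  shows "clinear (tensor_mult s)" "clinear (\<lambda>s. tensor_mult s t)"
proof -
  have 1: "clinear (\<lambda>s. tensor_mult s t)" for t :: "('a, 'b) tensor"
    unfolding tensor_mult_def by (intro clinear_tensor_lift tensor_mult_outer)
  have 2: "clinear (tensor_mult (x \<otimes>\<^sub>C y))" for x y
    unfolding tensor_mult_def tensor_lift_pure[OF tensor_mult_outer]
    by (rule clinear_tensor_lift[OF tensor_mult_inner])
  have "tensor_mult s (t + t') = tensor_mult s t + tensor_mult s t'" for t t'
    by (rule tensor_ext[of "\<lambda>s. tensor_mult s (t + t')"])
       (simp_all add: 1 clinear_add 2[unfolded clinear_iff])
  moreover have "tensor_mult s (e *\<^sub>C t) = e *\<^sub>C tensor_mult s t" for e t
    by (rule tensor_ext[of "\<lambda>s. tensor_mult s (e *\<^sub>C t)"])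
       (simp_all add: 1 clinear_scale 2[unfolded clinear_iff])
  ultimately show "clinear (tensor_mult s)" by (simp add: clinear_iff)
  show "clinear (\<lambda>s. tensor_mult s t)" by (rule 1)
qed

instantiation tensor :: (complex_algebra_1, complex_algebra_1) complex_algebra_1
begin
definition one_tensor :: "('a, 'b) tensor" where "one_tensor = 1 \<otimes>\<^sub>C 1"
definition times_tensor :: "('a, 'b) tensor \<Rightarrow> ('a, 'b) tensor \<Rightarrow> ('a, 'b) tensor"
  where "times_tensor = tensor_mult"
instance
proof
  fix r s t :: "('a, 'b) tensor" and c :: complex
  note lin = clinear_tensor_mult[unfolded clinear_iff, rule_format]
  show "r * s * t = r * (s * t)"
    unfolding times_tensor_def
  proof (rule tensor_ext[of "\<lambda>r. tensor_mult (tensor_mult r s) t" "\<lambda>r. tensor_mult r (tensor_mult s t)"])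
    show "clinear (\<lambda>r. tensor_mult (tensor_mult r s) t)" "clinear (\<lambda>r. tensor_mult r (tensor_mult s t))"
      by (simp_all add: clinear_iff lin)
    fix a b
    show "tensor_mult (tensor_mult (a \<otimes>\<^sub>C b) s) t = tensor_mult (a \<otimes>\<^sub>C b) (tensor_mult s t)"
    proof (rule tensor_ext[of "\<lambda>s. tensor_mult (tensor_mult (a \<otimes>\<^sub>C b) s) t"
            "\<lambda>s. tensor_mult (a \<otimes>\<^sub>C b) (tensor_mult s t)"])
      show "clinear (\<lambda>s. tensor_mult (tensor_mult (a \<otimes>\<^sub>C b) s) t)"
        "clinear (\<lambda>s. tensor_mult (a \<otimes>\<^sub>C b) (tensor_mult s t))"
        by (simp_all add: clinear_iff lin)
      fix c d
      show "tensor_mult (tensor_mult (a \<otimes>\<^sub>C b) (c \<otimes>\<^sub>C d)) t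
          = tensor_mult (a \<otimes>\<^sub>C b) (tensor_mult (c \<otimes>\<^sub>C d) t)"
        by (rule tensor_ext[of "\<lambda>t. tensor_mult (tensor_mult (a \<otimes>\<^sub>C b) (c \<otimes>\<^sub>C d)) t"
              "\<lambda>t. tensor_mult (a \<otimes>\<^sub>C b) (tensor_mult (c \<otimes>\<^sub>C d) t)"])
           (simp_all add: clinear_iff lin tensor_mult_pure mult.assoc)
    qed
  qed
  show "1 * t = t" unfolding times_tensor_def one_tensor_def
    by (rule tensor_ext[of "\<lambda>t. tensor_mult (1 \<otimes>\<^sub>C 1) t" "\<lambda>t. t"])
       (simp_all add: clinear_iff lin tensor_mult_pure)
  show "t * 1 = t" unfolding times_tensor_def one_tensor_def
    by (rule tensor_ext[of "\<lambda>t. tensor_mult t (1 \<otimes>\<^sub>C 1)" "\<lambda>t. t"])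
       (simp_all add: clinear_iff lin tensor_mult_pure)
qed (simp_all add: times_tensor_def clinear_tensor_mult[unfolded clinear_iff])
end

lemma mult_pure_tensor:
  "(a \<otimes>\<^sub>C b) * (c \<otimes>\<^sub>C d) = (a * c) \<otimes>\<^sub>C (b * d :: 'b::complex_algebra_1)"
  for a c :: "'a::complex_algebra_1"
  by (simp add: times_tensor_def tensor_mult_pure)


section \<open>Tensor powers\<close>

(* ('u, 'n) tpow is the tensor power of 'u with positions 'n; with the numeral type n as index type
   it is the n-fold tensor power, the positions being the residues 1, ..., n modulo n. *)

definition tpow_rels :: "(('n::finite \<Rightarrow> 'u::complex_vector) \<Rightarrow>\<^sub>0 complex) set" where
  "tpow_rels =
     {Poly_Mapping.single (u(i := x + y)) 1 - Poly_Mapping.single (u(i := x)) 1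
        - Poly_Mapping.single (u(i := y)) 1 | u i x y. True}
   \<union> {Poly_Mapping.single (u(i := c *\<^sub>C x)) 1 - c *\<^sub>C Poly_Mapping.single (u(i := x)) 1 | u i c x. True}"

definition tpow_rel ::
    "(('n::finite \<Rightarrow> 'u::complex_vector) \<Rightarrow>\<^sub>0 complex) \<Rightarrow> (('n \<Rightarrow> 'u) \<Rightarrow>\<^sub>0 complex) \<Rightarrow> bool"
  where "tpow_rel p q \<longleftrightarrow> p - q \<in> cvec.span tpow_rels"

quotient_type (overloaded) ('u, 'n) tpow = "('n::finite \<Rightarrow> 'u::complex_vector) \<Rightarrow>\<^sub>0 complex" / tpow_rel
  unfolding tpow_rel_def by (rule span_equivp)

lemma tpow_rel_refl: "p = q \<Longrightarrow> tpow_rel p q"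
  by (simp add: tpow_rel_def cvec.span_zero)

instantiation tpow :: (complex_vector, finite) complex_vector
begin
lift_definition zero_tpow :: "('a, 'b) tpow" is 0 .
lift_definition plus_tpow :: "('a, 'b) tpow \<Rightarrow> ('a, 'b) tpow \<Rightarrow> ('a, 'b) tpow"
  is "(+)" unfolding tpow_rel_def by (rule span_respects)
lift_definition minus_tpow :: "('a, 'b) tpow \<Rightarrow> ('a, 'b) tpow \<Rightarrow> ('a, 'b) tpow"
  is "(-)" unfolding tpow_rel_def by (rule span_respects)
lift_definition uminus_tpow :: "('a, 'b) tpow \<Rightarrow> ('a, 'b) tpow"
  is uminus unfolding tpow_rel_def by (rule span_respects)
lift_definition scaleC_tpow :: "complex \<Rightarrow> ('a, 'b) tpow \<Rightarrow> ('a, 'b) tpow"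
  is scaleC unfolding tpow_rel_def by (rule span_respects)
instance
  by standard (transfer, rule tpow_rel_refl,
      simp add: algebra_simps scaleC_add_right scaleC_add_left scaleC_scaleC scaleC_one)+
end

lift_definition pure_tpow :: "('n::finite \<Rightarrow> 'u::complex_vector) \<Rightarrow> ('u, 'n) tpow"
  is "\<lambda>u. Poly_Mapping.single u 1" .

definition cmultilinear :: "(('n \<Rightarrow> 'u::complex_vector) \<Rightarrow> 'c::complex_vector) \<Rightarrow> bool"
  where "cmultilinear f \<longleftrightarrow> (\<forall>u i. clinear (\<lambda>x. f (u(i := x))))"

(* As for tensor_lift, independent of the chosen representative when f is multilinear. *)
definition tpow_lift ::
    "(('n::finite \<Rightarrow> 'u::complex_vector) \<Rightarrow> 'c::complex_vector) \<Rightarrow> ('u, 'n) tpow \<Rightarrow> 'c"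
  where "tpow_lift f t = free_lift f (rep_tpow t)"

lemma tpow_lift_abs:
  assumes "cmultilinear f"
  shows "tpow_lift f (abs_tpow p) = free_lift f p"
proof -
  have "tpow_rel (rep_tpow (abs_tpow p)) p"
    by (meson Quotient3_rep_abs Quotient3_tpow tpow_rel_refl)
  then have *: "rep_tpow (abs_tpow p) - p \<in> cvec.span tpow_rels"
    by (simp add: tpow_rel_def)
  have "free_lift f (rep_tpow (abs_tpow p) - p) = 0"
    by (rule clinear_vanish_span[OF clinear_free_lift _ *])
       (use assms in \<open>auto simp: tpow_rels_def cmultilinear_def clinear_diff[OF clinear_free_lift]
          clinear_iff clinear_free_lift[unfolded clinear_iff] scaleC_one\<close>)
  then show ?thesis by (simp add: tpow_lift_def clinear_diff[OF clinear_free_lift])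
qed

lemma tpow_lift_pure [simp]: "cmultilinear f \<Longrightarrow> tpow_lift f (pure_tpow u) = f u"
  by (simp add: pure_tpow.abs_eq tpow_lift_abs scaleC_one)

lemma clinear_abs_tpow: "clinear abs_tpow"
  by (simp add: clinear_iff plus_tpow.abs_eq scaleC_tpow.abs_eq)

lemma clinear_tpow_lift:
  assumes "cmultilinear f"
  shows "clinear (tpow_lift f)"
proof -
  have "tpow_lift f (s + t) = tpow_lift f s + tpow_lift f t" for s t
    by (induct s, induct t)
       (simp add: plus_tpow.abs_eq tpow_lift_abs[OF assms] clinear_free_lift[unfolded clinear_iff])
  moreover have "tpow_lift f (c *\<^sub>C t) = c *\<^sub>C tpow_lift f t" for c t
    by (induct t)
       (simp add: scaleC_tpow.abs_eq tpow_lift_abs[OF assms] clinear_free_lift[unfolded clinear_iff])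
  ultimately show ?thesis by (simp add: clinear_iff)
qed

lemma tpow_ext:
  assumes "clinear F" "clinear G" "\<And>u. F (pure_tpow u) = G (pure_tpow u)"
  shows "F t = G t"
proof (induct t rule: tpow.abs_induct)
  fix p
  show "F (abs_tpow p) = G (abs_tpow p)"
    by (rule free_ext[of "\<lambda>p. F (abs_tpow p)" "\<lambda>p. G (abs_tpow p)"])
       (use assms in \<open>auto intro: clinear_compose[OF clinear_abs_tpow] simp: pure_tpow.abs_eq\<close>)
qed

lemma tpow_rels_intros:
  "Poly_Mapping.single (u(i := x + y)) 1
     - (Poly_Mapping.single (u(i := x)) 1 + Poly_Mapping.single (u(i := y)) 1) \<in> tpow_rels"
  "Poly_Mapping.single (u(i := c *\<^sub>C x)) 1 - c *\<^sub>C Poly_Mapping.single (u(i := x)) 1 \<in> tpow_rels"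
  unfolding tpow_rels_def diff_diff_add[symmetric] by blast+

lemma cmultilinear_pure_tpow: "cmultilinear pure_tpow"
proof -
  have *: "abs_tpow p = abs_tpow q" if "p - q \<in> tpow_rels" for p q :: "('a \<Rightarrow> 'b) \<Rightarrow>\<^sub>0 complex"
    using that by (simp add: tpow.abs_eq_iff tpow_rel_def cvec.span_base)
  show ?thesis
    unfolding cmultilinear_def clinear_iff pure_tpow.abs_eq plus_tpow.abs_eq scaleC_tpow.abs_eq
    by (intro conjI allI; rule *) (rule tpow_rels_intros)+
qed

lemmas clinear_pure_tpow = cmultilinear_pure_tpow[unfolded cmultilinear_def]

definition tpow_mult ::
    "('u::complex_algebra_1, 'n::finite) tpow \<Rightarrow> ('u, 'n) tpow \<Rightarrow> ('u, 'n) tpow"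
  where "tpow_mult s t = tpow_lift (\<lambda>u. tpow_lift (\<lambda>v. pure_tpow (\<lambda>i. u i * v i)) t) s"

lemma fun_upd_mult:
  "(\<lambda>j. (u(i := x)) j * v j) = (\<lambda>j. u j * v j)(i := x * v i)"
  "(\<lambda>j. u j * (v(i := x)) j) = (\<lambda>j. u j * v j)(i := u i * x)"
  by auto

lemma tpow_mult_inner:
  "cmultilinear (\<lambda>v. pure_tpow (\<lambda>i. u i * v i :: 'u::complex_algebra_1) :: ('u, 'n::finite) tpow)"
  unfolding cmultilinear_def fun_upd_mult
  by (auto intro: clinear_compose[OF clinear_mult_right] clinear_pure_tpow[rule_format])

lemma tpow_mult_outer:
  "cmultilinear (\<lambda>u. tpow_lift (\<lambda>v. pure_tpow (\<lambda>i. u i * v i)) t :: ('u::complex_algebra_1, 'n::finite) tpow)"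
proof -
  note pur = clinear_pure_tpow[unfolded clinear_iff]
  define L :: "('n \<Rightarrow> 'u) \<Rightarrow> ('u, 'n) tpow \<Rightarrow> ('u, 'n) tpow"
    where "L u = tpow_lift (\<lambda>v. pure_tpow (\<lambda>i. u i * v i))" for u
  have lin: "clinear (L u)" for u
    unfolding L_def by (rule clinear_tpow_lift[OF tpow_mult_inner])
  have L: "L u (pure_tpow v) = pure_tpow (\<lambda>i. u i * v i)" for u v
    unfolding L_def by (rule tpow_lift_pure[OF tpow_mult_inner])
  have "L (u(i := x + y)) t = L (u(i := x)) t + L (u(i := y)) t" for u i x y
    by (rule tpow_ext[of "L (u(i := x + y))"])
       (simp_all add: lin L fun_upd_mult distrib_right pur clinear_add del: fun_upd_apply)
  moreover have "L (u(i := e *\<^sub>C x)) t = e *\<^sub>C L (u(i := x)) t" for u i e x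
    by (rule tpow_ext[of "L (u(i := e *\<^sub>C x))"])
       (simp_all add: lin L fun_upd_mult mult_scaleC_left pur clinear_scale del: fun_upd_apply)
  ultimately have "cmultilinear (\<lambda>u. L u t)"
    by (simp add: cmultilinear_def clinear_iff del: fun_upd_apply)
  then show ?thesis by (simp add: L_def)
qed

lemma tpow_mult_pure: "tpow_mult (pure_tpow u) (pure_tpow v) = pure_tpow (\<lambda>i. u i * v i)"
  unfolding tpow_mult_def
  by (subst tpow_lift_pure[OF tpow_mult_outer]) (rule tpow_lift_pure[OF tpow_mult_inner])

lemma clinear_tpow_mult:
  fixes s t :: "('a::complex_algebra_1, 'b::finite) tpow"
  shows "clinear (tpow_mult s)" "clinear (\<lambda>s. tpow_mult s t)"
proof -
  have 1: "clinear (\<lambda>s. tpow_mult s t)" for t :: "('a, 'b) tpow"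
    unfolding tpow_mult_def by (intro clinear_tpow_lift tpow_mult_outer)
  have 2: "clinear (tpow_mult (pure_tpow u))" for u
    unfolding tpow_mult_def tpow_lift_pure[OF tpow_mult_outer]
    by (rule clinear_tpow_lift[OF tpow_mult_inner])
  have "tpow_mult s (t + t') = tpow_mult s t + tpow_mult s t'" for t t'
    by (rule tpow_ext[of "\<lambda>s. tpow_mult s (t + t')"])
       (simp_all add: 1 clinear_add 2[unfolded clinear_iff])
  moreover have "tpow_mult s (e *\<^sub>C t) = e *\<^sub>C tpow_mult s t" for e t
    by (rule tpow_ext[of "\<lambda>s. tpow_mult s (e *\<^sub>C t)"])
       (simp_all add: 1 clinear_scale 2[unfolded clinear_iff])
  ultimately show "clinear (tpow_mult s)" by (simp add: clinear_iff)
  show "clinear (\<lambda>s. tpow_mult s t)" by (rule 1)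
qed

instantiation tpow :: (complex_algebra_1, finite) complex_algebra_1
begin
definition one_tpow :: "('a, 'b) tpow" where "one_tpow = pure_tpow (\<lambda>_. 1)"
definition times_tpow :: "('a, 'b) tpow \<Rightarrow> ('a, 'b) tpow \<Rightarrow> ('a, 'b) tpow"
  where "times_tpow = tpow_mult"
instance
proof
  fix r s t :: "('a, 'b) tpow" and c :: complex
  note lin = clinear_tpow_mult[unfolded clinear_iff, rule_format]
  show "r * s * t = r * (s * t)"
    unfolding times_tpow_def
  proof (rule tpow_ext[of "\<lambda>r. tpow_mult (tpow_mult r s) t" "\<lambda>r. tpow_mult r (tpow_mult s t)"])
    show "clinear (\<lambda>r. tpow_mult (tpow_mult r s) t)" "clinear (\<lambda>r. tpow_mult r (tpow_mult s t))"
      by (simp_all add: clinear_iff lin)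
    fix u
    show "tpow_mult (tpow_mult (pure_tpow u) s) t = tpow_mult (pure_tpow u) (tpow_mult s t)"
    proof (rule tpow_ext[of "\<lambda>s. tpow_mult (tpow_mult (pure_tpow u) s) t"
            "\<lambda>s. tpow_mult (pure_tpow u) (tpow_mult s t)"])
      show "clinear (\<lambda>s. tpow_mult (tpow_mult (pure_tpow u) s) t)"
        "clinear (\<lambda>s. tpow_mult (pure_tpow u) (tpow_mult s t))"
        by (simp_all add: clinear_iff lin)
      fix v
      show "tpow_mult (tpow_mult (pure_tpow u) (pure_tpow v)) t
          = tpow_mult (pure_tpow u) (tpow_mult (pure_tpow v) t)"
        by (rule tpow_ext[of "\<lambda>t. tpow_mult (tpow_mult (pure_tpow u) (pure_tpow v)) t"
              "\<lambda>t. tpow_mult (pure_tpow u) (tpow_mult (pure_tpow v) t)"])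
           (simp_all add: clinear_iff lin tpow_mult_pure mult.assoc)
    qed
  qed
  show "1 * t = t" unfolding times_tpow_def one_tpow_def
    by (rule tpow_ext[of "\<lambda>t. tpow_mult (pure_tpow (\<lambda>_. 1)) t" "\<lambda>t. t"])
       (simp_all add: clinear_iff lin tpow_mult_pure)
  show "t * 1 = t" unfolding times_tpow_def one_tpow_def
    by (rule tpow_ext[of "\<lambda>t. tpow_mult t (pure_tpow (\<lambda>_. 1))" "\<lambda>t. t"])
       (simp_all add: clinear_iff lin tpow_mult_pure)
qed (simp_all add: times_tpow_def clinear_tpow_mult[unfolded clinear_iff])
end

lemma mult_pure_tpow: "pure_tpow u * pure_tpow v = pure_tpow (\<lambda>i. u i * v i :: 'u::complex_algebra_1)"
  by (simp add: times_tpow_def tpow_mult_pure)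

definition tpow_map ::
    "('n::finite \<Rightarrow> 'u::complex_vector \<Rightarrow> 'w::complex_vector) \<Rightarrow> ('u, 'n) tpow \<Rightarrow> ('w, 'n) tpow"
  where "tpow_map g = tpow_lift (\<lambda>u. pure_tpow (\<lambda>i. g i (u i)))"

lemma tpow_map_pure:
  assumes "\<And>i. clinear (g i)"
  shows "tpow_map g (pure_tpow u) = pure_tpow (\<lambda>i. g i (u i))"
    and "clinear (tpow_map g)"
proof -
  have *: "(\<lambda>j. g j ((u(i := x)) j)) = (\<lambda>j. g j (u j))(i := g i x)" for u i x
    by auto
  have "cmultilinear (\<lambda>u. pure_tpow (\<lambda>i. g i (u i)))"
    unfolding cmultilinear_def *
    by (auto intro: clinear_compose[OF assms] clinear_pure_tpow[rule_format])
  then show "tpow_map g (pure_tpow u) = pure_tpow (\<lambda>i. g i (u i))" "clinear (tpow_map g)"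
    by (simp_all add: tpow_map_def clinear_tpow_lift)
qed

(* For an injective choice i of positions: the j-th component is put into position i j, and 1 into
   the positions outside the range of i. *)
definition tpow_legs ::
    "('k::finite \<Rightarrow> 'n::finite) \<Rightarrow> ('u::complex_algebra_1, 'k) tpow \<Rightarrow> ('u, 'n) tpow"
  where "tpow_legs i = tpow_lift (\<lambda>u. pure_tpow (\<lambda>m. if m \<in> range i then u (inv i m) else 1))"

lemma tpow_legs_pure:
  fixes i :: "'k::finite \<Rightarrow> 'n::finite" and u :: "'k \<Rightarrow> 'u::complex_algebra_1"
  assumes "inj i"
  shows "tpow_legs i (pure_tpow u) = pure_tpow (\<lambda>m. if m \<in> range i then u (inv i m) else 1)"
    and "clinear (tpow_legs i :: ('u, 'k) tpow \<Rightarrow> ('u, 'n) tpow)"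
proof -
  have *: "(\<lambda>m. if m \<in> range i then (u(j := x)) (inv i m) else 1)
      = (\<lambda>m. if m \<in> range i then u (inv i m) else 1)(i j := x)" for u :: "'k \<Rightarrow> 'u" and j x
    using assms by (auto simp: fun_eq_iff)
  have "cmultilinear (\<lambda>u :: 'k \<Rightarrow> 'u. pure_tpow (\<lambda>m. if m \<in> range i then u (inv i m) else 1))"
    unfolding cmultilinear_def * using clinear_pure_tpow by auto
  then show "tpow_legs i (pure_tpow u) = pure_tpow (\<lambda>m. if m \<in> range i then u (inv i m) else 1)"
    and "clinear (tpow_legs i :: ('u, 'k) tpow \<Rightarrow> ('u, 'n) tpow)"
    by (simp_all add: tpow_legs_def clinear_tpow_lift)
qed

definition tpow_at :: "'n::finite \<Rightarrow> 'u::complex_algebra_1 \<Rightarrow> ('u, 'n) tpow"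
  where "tpow_at i x = pure_tpow (\<lambda>m. if m = i then x else 1)"


section \<open>The dual space\<close>

typedef (overloaded) 'v dual = "{f :: 'v::complex_vector \<Rightarrow> complex. clinear f}"
  morphisms dual_apply Abs_dual
  by (rule exI[of _ "\<lambda>_. 0"]) (simp add: clinear_iff)

setup_lifting type_definition_dual

instantiation dual :: (complex_vector) complex_vector
begin
lift_definition zero_dual :: "'a dual" is "\<lambda>_. 0" by (simp add: clinear_iff)
lift_definition plus_dual :: "'a dual \<Rightarrow> 'a dual \<Rightarrow> 'a dual" is "\<lambda>f g x. f x + g x"
  by (rule clinear_add)
lift_definition minus_dual :: "'a dual \<Rightarrow> 'a dual \<Rightarrow> 'a dual" is "\<lambda>f g x. f x - g x"
  by (simp add: clinear_iff scaleC_complex_def algebra_simps)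
lift_definition uminus_dual :: "'a dual \<Rightarrow> 'a dual" is "\<lambda>f x. - f x"
  by (simp add: clinear_iff scaleC_complex_def algebra_simps)
lift_definition scaleC_dual :: "complex \<Rightarrow> 'a dual \<Rightarrow> 'a dual" is "\<lambda>c f x. c * f x"
  by (simp add: clinear_iff scaleC_complex_def algebra_simps)
instance by standard (transfer, simp add: fun_eq_iff algebra_simps)+
end

(* The topology of pointwise convergence; for finite dimensional 'v it is the usual topology of the
   finite dimensional complex vector space 'v dual. *)
instantiation dual :: (complex_vector) topological_space
begin
definition open_dual :: "'a dual set \<Rightarrow> bool"
  where "open_dual S \<longleftrightarrow> (\<exists>T :: ('a \<Rightarrow> complex) set. open T \<and> S = dual_apply -` T)"
instance
proof
  show "open (UNIV :: 'a dual set)" unfolding open_dual_def by (rule exI[of _ UNIV]) auto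
next
  fix S T :: "'a dual set" assume "open S" "open T"
  then show "open (S \<inter> T)" unfolding open_dual_def by (metis open_Int vimage_Int)
next
  fix K :: "'a dual set set" assume "\<forall>S\<in>K. open S"
  then obtain T :: "'a dual set \<Rightarrow> ('a \<Rightarrow> complex) set"
    where T: "\<And>S. S \<in> K \<Longrightarrow> open (T S) \<and> S = dual_apply -` T S"
    unfolding open_dual_def by metis
  then have "open (\<Union>S\<in>K. T S)" "\<Union>K = dual_apply -` (\<Union>S\<in>K. T S)"
    by auto
  then show "open (\<Union>K)" unfolding open_dual_def by blast
qed
end

instance dual :: (complex_vector) t2_space
proof
  fix f g :: "'a dual" assume "f \<noteq> g"
  then have "dual_apply f \<noteq> dual_apply g" by (simp add: dual_apply_inject)
  then obtain x where x: "dual_apply f x \<noteq> dual_apply g x" by auto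
  obtain U V where UV: "open U" "open V" "dual_apply f x \<in> U" "dual_apply g x \<in> V" "U \<inter> V = {}"
    using hausdorff[OF x] by blast
  have o: "open ((\<lambda>p :: 'a \<Rightarrow> complex. p x) -` T)" if "open T" for T
    using that by (rule open_vimage) (rule continuous_on_product_coordinates)
  have "open {h :: 'a dual. dual_apply h x \<in> T}" if "open T" for T
    unfolding open_dual_def using o[OF that] by (intro exI[of _ "(\<lambda>p. p x) -` T"]) auto
  from this[OF UV(1)] this[OF UV(2)] UV(3-5)
  show "\<exists>U V. open U \<and> open V \<and> f \<in> U \<and> g \<in> V \<and> U \<inter> V = {}"
    by (intro exI[of _ "{h. dual_apply h x \<in> U}"] exI[of _ "{h. dual_apply h x \<in> V}"]) auto
qed

lemma continuous_on_dual:
  fixes F :: "'t::topological_space \<Rightarrow> 'v::complex_vector dual"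
  assumes "\<And>x. continuous_on S (\<lambda>t. dual_apply (F t) x)"
  shows "continuous_on S F"
  unfolding continuous_on_open_invariant
proof (intro allI impI)
  fix B :: "'v dual set" assume "open B"
  then obtain T where T: "open T" "B = dual_apply -` T" unfolding open_dual_def by auto
  have "continuous_on S (\<lambda>t. dual_apply (F t))"
    by (rule continuous_on_coordinatewise_then_product) (rule assms)
  then obtain A where "open A" "A \<inter> S = (\<lambda>t. dual_apply (F t)) -` T \<inter> S"
    using T(1) unfolding continuous_on_open_invariant by blast
  then show "\<exists>A. open A \<and> A \<inter> S = F -` B \<inter> S" using T(2) by auto
qed

lemma continuous_on_dual_apply: "continuous_on S (\<lambda>l. dual_apply l x)"
proof -
  have "continuous_on UNIV (dual_apply :: 'a dual \<Rightarrow> _)"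
    unfolding continuous_on_open_vimage[OF open_UNIV] by (auto simp: open_dual_def)
  then have "continuous_on UNIV (\<lambda>l. dual_apply l x)"
    by (rule continuous_on_product_then_coordinatewise)
  then show ?thesis by (rule continuous_on_subset) simp
qed

lemma continuous_on_line [continuous_intros]:
  fixes F :: "'t::topological_space \<Rightarrow> 'v::complex_vector dual"
  assumes "continuous_on S F" "continuous_on S z"
  shows "continuous_on S (\<lambda>t. F t + z t *\<^sub>C m)"
proof (rule continuous_on_dual)
  fix x
  have "continuous_on S (\<lambda>t. dual_apply (F t) x + z t * dual_apply m x)"
    by (intro continuous_intros assms continuous_on_compose2[OF continuous_on_dual_apply[of UNIV] assms(1)]) auto
  then show "continuous_on S (\<lambda>t. dual_apply (F t + z t *\<^sub>C m) x)"
    by (simp add: plus_dual.rep_eq scaleC_dual.rep_eq)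
qed

lemma open_line: "open W \<Longrightarrow> open {z. l + z *\<^sub>C m \<in> W}" for l m :: "'v::complex_vector dual"
  using continuous_on_line[of UNIV "\<lambda>_. l" "\<lambda>z. z" m]
  by (simp add: continuous_on_open_vimage vimage_def)

lemma line_nbhd:
  fixes l m :: "'v::complex_vector dual"
  assumes "open W" "l \<in> W"
  obtains N e where "open N" "l \<in> N" "e > 0" "\<And>x z. x \<in> N \<Longrightarrow> norm z \<le> e \<Longrightarrow> x + z *\<^sub>C m \<in> W"
proof -
  have "continuous_on UNIV (\<lambda>p :: 'v dual \<times> complex. fst p + snd p *\<^sub>C m)"
    by (intro continuous_intros)
  then have "open {p :: 'v dual \<times> complex. fst p + snd p *\<^sub>C m \<in> W}"
    using assms(1) by (simp add: continuous_on_open_vimage vimage_def)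
  moreover have "(l, 0) \<in> {p :: 'v dual \<times> complex. fst p + snd p *\<^sub>C m \<in> W}"
    using assms(2) by simp
  ultimately obtain A B where AB: "open A" "open B" "l \<in> A" "0 \<in> B"
      "A \<times> B \<subseteq> {p. fst p + snd p *\<^sub>C m \<in> W}"
    by (elim open_prod_elim) auto
  obtain e where e: "e > 0" "cball 0 e \<subseteq> B"
    using AB(2,4) open_contains_cball by blast
  have "x + z *\<^sub>C m \<in> W" if "x \<in> A" "norm z \<le> e" for x z
    using that e(2) AB(5) by (force simp: subset_iff)
  with that AB e(1) show ?thesis by blast
qed


section \<open>Holomorphic functions on open subsets of the dual space\<close>

(* Continuous and holomorphic along every affine complex line: by Osgood's lemma this is the usual
   notion of a holomorphic function of several variables when 'v is finite dimensional. *)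
definition dual_holomorphic_on :: "('v::complex_vector dual \<Rightarrow> complex) \<Rightarrow> 'v dual set \<Rightarrow> bool"
  where "dual_holomorphic_on f W \<longleftrightarrow>
    continuous_on W f \<and> (\<forall>l\<in>W. \<forall>m. (\<lambda>z. f (l + z *\<^sub>C m)) field_differentiable at 0)"

definition dir_deriv :: "'v::complex_vector dual \<Rightarrow> ('v dual \<Rightarrow> complex) \<Rightarrow> 'v dual \<Rightarrow> complex"
  where "dir_deriv m f l = deriv (\<lambda>z. f (l + z *\<^sub>C m)) 0"

lemma line_add: "l + (z + w) *\<^sub>C m = (l + z *\<^sub>C m) + w *\<^sub>C m" for l m :: "'v::complex_vector"
  by (simp add: scaleC_add_left algebra_simps)

lemma dual_holomorphic_on_line_deriv:
  assumes "dual_holomorphic_on f W" "l + z *\<^sub>C m \<in> W"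
  shows "((\<lambda>z. f (l + z *\<^sub>C m)) has_field_derivative dir_deriv m f (l + z *\<^sub>C m)) (at z)"
proof -
  have "((\<lambda>w. f ((l + z *\<^sub>C m) + w *\<^sub>C m)) has_field_derivative dir_deriv m f (l + z *\<^sub>C m)) (at 0)"
    using assms unfolding dual_holomorphic_on_def dir_deriv_def by (simp add: DERIV_deriv_iff_field_differentiable)
  then have "((\<lambda>w. f (l + (z + w) *\<^sub>C m)) has_field_derivative dir_deriv m f (l + z *\<^sub>C m)) (at 0)"
    by (simp only: line_add)
  then show ?thesis
    using DERIV_shift[of "\<lambda>w. f (l + w *\<^sub>C m)" "dir_deriv m f (l + z *\<^sub>C m)" 0 z]
    by (simp add: add.commute)
qed

lemma dual_holomorphic_on_subset: "dual_holomorphic_on f W \<Longrightarrow> V \<subseteq> W \<Longrightarrow> dual_holomorphic_on f V"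
  unfolding dual_holomorphic_on_def by (meson continuous_on_subset subsetD)

lemma dual_holomorphic_on_const: "dual_holomorphic_on (\<lambda>_. c) W"
  and dual_holomorphic_on_add: "dual_holomorphic_on f W \<Longrightarrow> dual_holomorphic_on g W \<Longrightarrow> dual_holomorphic_on (\<lambda>l. f l + g l) W"
  and dual_holomorphic_on_diff: "dual_holomorphic_on f W \<Longrightarrow> dual_holomorphic_on g W \<Longrightarrow> dual_holomorphic_on (\<lambda>l. f l - g l) W"
  and dual_holomorphic_on_mult: "dual_holomorphic_on f W \<Longrightarrow> dual_holomorphic_on g W \<Longrightarrow> dual_holomorphic_on (\<lambda>l. f l * g l) W"
  unfolding dual_holomorphic_on_def
  by (auto intro!: continuous_intros derivative_intros field_differentiable_add field_differentiable_diff
      field_differentiable_mult)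

lemma dir_deriv_integral:
  assumes f: "dual_holomorphic_on f W" and e: "e > 0"
    and W: "\<And>z. norm z \<le> e \<Longrightarrow> l + z *\<^sub>C m \<in> W"
  shows "dir_deriv m f l = 1 / (2 * of_real pi * \<i>) *
    integral {0..2*pi} (\<lambda>t. f (l + (of_real e * cis t) *\<^sub>C m) / (of_real e * cis t)\<^sup>2 * of_real e * \<i> * cis t)"
proof -
  let ?h = "\<lambda>z. f (l + z *\<^sub>C m)"
  have d: "(?h has_field_derivative dir_deriv m f (l + z *\<^sub>C m)) (at z)" if "norm z \<le> e" for z
    using dual_holomorphic_on_line_deriv[OF f W[OF that]] .
  then have hol: "?h holomorphic_on cball 0 e"
    unfolding holomorphic_on_def field_differentiable_def
    by (meson DERIV_subset mem_cball_0 top_greatest)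
  have "(?h has_field_derivative (1 / (2 * of_real pi * \<i>)
      * contour_integral (circlepath 0 e) (\<lambda>u. ?h u / (u - 0)^2))) (at 0)"
    by (rule Cauchy_derivative_integral_circlepath)
       (use hol e in \<open>auto intro: holomorphic_on_imp_continuous_on holomorphic_on_subset\<close>)
  then have "dir_deriv m f l = 1 / (2 * of_real pi * \<i>)
      * contour_integral (circlepath 0 e) (\<lambda>u. ?h u / u^2)"
    unfolding dir_deriv_def by (simp add: DERIV_imp_deriv)
  then show ?thesis
    by (simp add: circlepath_def contour_integral_part_circlepath_eq)
qed

lemma dual_holomorphic_on_continuous_dir_deriv:
  assumes "dual_holomorphic_on f W" "open W"
  shows "continuous_on W (dir_deriv m f)"
proof -
  have "continuous (at l) (dir_deriv m f)" if l: "l \<in> W" for l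
  proof -
    obtain N e where N: "open N" "l \<in> N" "e > 0" "\<And>x z. x \<in> N \<Longrightarrow> norm z \<le> e \<Longrightarrow> x + z *\<^sub>C m \<in> W"
      using line_nbhd[OF assms(2) l] by metis
    have *: "continuous_on (N \<times> {0..2*pi}) (\<lambda>p. f (fst p + (of_real e * cis (snd p)) *\<^sub>C m))"
      by (rule continuous_on_compose2[of W f])
         (use assms N in \<open>auto simp: dual_holomorphic_on_def norm_mult intro!: continuous_intros\<close>)
    have "continuous_on N (\<lambda>x. integral (cbox 0 (2*pi))
      (\<lambda>t. f (x + (of_real e * cis t) *\<^sub>C m) / (of_real e * cis t)\<^sup>2 * of_real e * \<i> * cis t))"
      by (rule integral_continuous_on_param, unfold case_prod_unfold)
         (use N(3) in \<open>auto intro!: continuous_intros *\<close>)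
    then have "continuous_on N (\<lambda>x. 1 / (2 * of_real pi * \<i>) * integral {0..2*pi}
      (\<lambda>t. f (x + (of_real e * cis t) *\<^sub>C m) / (of_real e * cis t)\<^sup>2 * of_real e * \<i> * cis t))"
      by (intro continuous_intros) simp
    then have "continuous_on N (dir_deriv m f)"
      by (rule continuous_on_eq)
         (use dir_deriv_integral[OF assms(1) N(3)] N(4) in auto)
    then show ?thesis using N(1,2) continuous_on_eq_continuous_at by blast
  qed
  then show ?thesis by (simp add: continuous_at_imp_continuous_on)
qed

lemma dual_holomorphic_on_dir_deriv:
  assumes f: "dual_holomorphic_on f W" and W: "open W"
  shows "dual_holomorphic_on (dir_deriv m f) W"
  unfolding dual_holomorphic_on_def
proof (intro conjI ballI allI)
  show "continuous_on W (dir_deriv m f)"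
    using assms by (rule dual_holomorphic_on_continuous_dir_deriv)
  fix l n assume l: "l \<in> W"
  obtain N e where N: "open N" "l \<in> N" "e > 0" "\<And>x z. x \<in> N \<Longrightarrow> norm z \<le> e \<Longrightarrow> x + z *\<^sub>C m \<in> W"
    using line_nbhd[OF W l] by metis
  have "open {w. l + w *\<^sub>C n \<in> N}" using N(1) by (rule open_line)
  moreover have "0 \<in> {w. l + w *\<^sub>C n \<in> N}" using N(2) by simp
  ultimately obtain d where d: "d > 0" "ball 0 d \<subseteq> {w. l + w *\<^sub>C n \<in> N}"
    using openE by blast
  let ?p = "\<lambda>w t. l + w *\<^sub>C n + (of_real e * cis t) *\<^sub>C m"
  let ?k = "\<lambda>t. of_real e * \<i> * cis t / (of_real e * cis t)\<^sup>2"
  have p: "?p w t \<in> W" if "w \<in> ball 0 d" for w t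
    using that d(2) N(3,4) by (auto simp: norm_mult)
  have p': "?p w t = (l + (of_real e * cis t) *\<^sub>C m) + w *\<^sub>C n" for w t
    by (simp add: algebra_simps)
  have cp: "continuous_on (ball 0 d \<times> cbox 0 (2*pi)) (\<lambda>q. ?p (fst q) (snd q))"
    by (intro continuous_intros)
  have der: "((\<lambda>w. f (?p w t) * ?k t) has_field_derivative dir_deriv n f (?p w t) * ?k t) (at w within ball 0 d)"
    if "w \<in> ball 0 d" for w t
    by (rule DERIV_cmult_right, rule DERIV_subset[OF _ subset_UNIV])
       (use dual_holomorphic_on_line_deriv[OF f, of "l + (of_real e * cis t) *\<^sub>C m" w n] p[OF that] in \<open>simp add: p'\<close>)
  have int: "(\<lambda>t. f (?p w t) * ?k t) integrable_on cbox 0 (2*pi)" if "w \<in> ball 0 d" for w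
  proof (rule integrable_continuous)
    have "continuous_on (cbox 0 (2*pi)) (\<lambda>t. f (?p w t))"
      by (rule continuous_on_compose2[of W f])
         (use f p[OF that] in \<open>auto simp: dual_holomorphic_on_def intro!: continuous_intros\<close>)
    then show "continuous_on (cbox 0 (2*pi)) (\<lambda>t. f (?p w t) * ?k t)"
      using N(3) by (auto intro!: continuous_intros)
  qed
  have "continuous_on (ball 0 d \<times> cbox 0 (2*pi)) (\<lambda>q. dir_deriv n f (?p (fst q) (snd q)))"
    by (rule continuous_on_compose2[OF dual_holomorphic_on_continuous_dir_deriv[OF f W] cp]) (use p in auto)
  then have cont: "continuous_on (ball 0 d \<times> cbox 0 (2*pi)) (\<lambda>(w, t). dir_deriv n f (?p w t) * ?k t)"
    using N(3) unfolding case_prod_unfold by (auto intro!: continuous_intros)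
  have "((\<lambda>w. integral (cbox 0 (2*pi)) (\<lambda>t. f (?p w t) * ?k t)) has_field_derivative
      integral (cbox 0 (2*pi)) (\<lambda>t. dir_deriv n f (?p 0 t) * ?k t)) (at 0 within ball 0 d)"
    by (rule leibniz_rule_field_derivative[OF der int cont]) (use d in auto)
  then have "((\<lambda>w. 1 / (2 * of_real pi * \<i>) * integral {0..2*pi} (\<lambda>t. f (?p w t) * ?k t)) has_field_derivative
      1 / (2 * of_real pi * \<i>) * integral {0..2*pi} (\<lambda>t. dir_deriv n f (?p 0 t) * ?k t)) (at 0)"
    using d(1) by (intro DERIV_cmult) (simp add: at_within_open[of 0 "ball 0 d"])
  moreover have "1 / (2 * of_real pi * \<i>) * integral {0..2*pi} (\<lambda>t. f (?p w t) * ?k t) = dir_deriv m f (l + w *\<^sub>C n)"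
    if "w \<in> ball 0 d" for w
    using dir_deriv_integral[OF f N(3), of "l + w *\<^sub>C n" m] N(4) that d(2)
    by (simp add: subset_iff mult.assoc)
  ultimately have "((\<lambda>w. dir_deriv m f (l + w *\<^sub>C n)) has_field_derivative
      1 / (2 * of_real pi * \<i>) * integral {0..2*pi} (\<lambda>t. dir_deriv n f (?p 0 t) * ?k t)) (at 0)"
    using has_field_derivative_transform_within_open[of _ _ 0 "ball 0 d" "\<lambda>w. dir_deriv m f (l + w *\<^sub>C n)"] d(1)
    by fastforce
  then show "(\<lambda>w. dir_deriv m f (l + w *\<^sub>C n)) field_differentiable at 0"
    unfolding field_differentiable_def by blast
qed


section \<open>Meromorphic functions on the dual space\<close>

(* Locally a quotient g / h of holomorphic functions with h vanishing identically on no nonempty open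
   subset. The values at the zeros of h are arbitrary: the type mero below identifies two functions
   which agree on a dense open set, i.e. which define the same quotient g / h locally. *)
definition dual_meromorphic :: "('v::complex_vector dual \<Rightarrow> complex) \<Rightarrow> bool"
  where "dual_meromorphic F \<longleftrightarrow> (\<forall>l. \<exists>V g h. open V \<and> l \<in> V \<and>
    dual_holomorphic_on g V \<and> dual_holomorphic_on h V \<and>
    V \<subseteq> closure {x\<in>V. h x \<noteq> 0} \<and> (\<forall>x\<in>V. h x \<noteq> 0 \<longrightarrow> F x = g x / h x))"

definition eq_dense_open :: "('t::topological_space \<Rightarrow> 'c) \<Rightarrow> ('t \<Rightarrow> 'c) \<Rightarrow> bool"
  where "eq_dense_open F G \<longleftrightarrow> (\<exists>S. open S \<and> closure S = UNIV \<and> (\<forall>x\<in>S. F x = G x))"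

definition mero_rel :: "('v::complex_vector dual \<Rightarrow> complex) \<Rightarrow> ('v dual \<Rightarrow> complex) \<Rightarrow> bool"
  where "mero_rel F G \<longleftrightarrow> dual_meromorphic F \<and> dual_meromorphic G \<and> eq_dense_open F G"

lemma closure_Int_dense_open:
  assumes "open A" "open V" "V \<subseteq> closure A" "V \<subseteq> closure B"
  shows "V \<subseteq> closure (A \<inter> B)"
proof
  fix x assume x: "x \<in> V"
  show "x \<in> closure (A \<inter> B)"
    unfolding closure_iff_nhds_not_empty
  proof safe
    fix U T assume T: "T \<subseteq> U" "open T" "x \<in> T" "(A \<inter> B) \<inter> U = {}"
    have "x \<in> closure A" using x assms(3) by auto
    moreover have "open (T \<inter> V)" "x \<in> T \<inter> V" using T assms(2) x by auto
    ultimately obtain y where y: "y \<in> A" "y \<in> T \<inter> V"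
      unfolding closure_iff_nhds_not_empty by blast
    then have "y \<in> closure B" using assms(4) by auto
    moreover have "open (T \<inter> V \<inter> A)" "y \<in> T \<inter> V \<inter> A" using y \<open>open (T \<inter> V)\<close> assms(1) by auto
    ultimately obtain w where "w \<in> B" "w \<in> T \<inter> V \<inter> A"
      unfolding closure_iff_nhds_not_empty by blast
    then show False using T by blast
  qed
qed

lemma eq_dense_open_refl [simp]: "eq_dense_open F F"
  unfolding eq_dense_open_def by (rule exI[of _ UNIV]) auto

lemma eq_dense_open_sym: "eq_dense_open F G \<Longrightarrow> eq_dense_open G F"
  unfolding eq_dense_open_def by force

lemma eq_dense_open_combine:
  assumes "eq_dense_open F F'" "eq_dense_open G G'"
    and "\<And>x. F x = F' x \<Longrightarrow> G x = G' x \<Longrightarrow> H x = H' x"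
  shows "eq_dense_open H H'"
proof -
  obtain S T where "open S" "closure S = UNIV" "\<forall>x\<in>S. F x = F' x"
    "open T" "closure T = UNIV" "\<forall>x\<in>T. G x = G' x"
    using assms(1,2) unfolding eq_dense_open_def by auto
  then show ?thesis
    unfolding eq_dense_open_def
    using closure_Int_dense_open[of S UNIV T] assms(3)
    by (intro exI[of _ "S \<inter> T"]) auto
qed

lemma dual_meromorphic_local:
  assumes "dual_meromorphic F"
  obtains V g h where "open V" "l \<in> V" "dual_holomorphic_on g V" "dual_holomorphic_on h V"
    "V \<subseteq> closure {x\<in>V. h x \<noteq> 0}" "\<forall>x\<in>V. h x \<noteq> 0 \<longrightarrow> F x = g x / h x"
  using assms unfolding dual_meromorphic_def by meson

lemma open_nonzero:
  assumes "open V" "dual_holomorphic_on h V"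
  shows "open {x\<in>V. h x \<noteq> 0}"
proof -
  have "open (h -` (- {0}) \<inter> V)"
    using assms by (intro continuous_on_open_vimage[THEN iffD1, rule_format]) (auto simp: dual_holomorphic_on_def)
  moreover have "h -` (- {0}) \<inter> V = {x\<in>V. h x \<noteq> 0}" by auto
  ultimately show ?thesis by simp
qed

lemma dual_meromorphic_local2:
  assumes "dual_meromorphic F" "dual_meromorphic G"
  obtains V f h g k where "open V" "l \<in> V" "dual_holomorphic_on f V" "dual_holomorphic_on h V"
    "dual_holomorphic_on g V" "dual_holomorphic_on k V"
    "V \<subseteq> closure {x\<in>V. h x * k x \<noteq> 0}" "\<forall>x\<in>V. h x \<noteq> 0 \<longrightarrow> F x = f x / h x"
    "\<forall>x\<in>V. k x \<noteq> 0 \<longrightarrow> G x = g x / k x"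
proof -
  obtain V f h where V: "open V" "l \<in> V" "dual_holomorphic_on f V" "dual_holomorphic_on h V"
    "V \<subseteq> closure {x\<in>V. h x \<noteq> 0}" "\<forall>x\<in>V. h x \<noteq> 0 \<longrightarrow> F x = f x / h x"
    by (rule dual_meromorphic_local[OF assms(1), of l]) blast
  obtain W g k where W: "open W" "l \<in> W" "dual_holomorphic_on g W" "dual_holomorphic_on k W"
    "W \<subseteq> closure {x\<in>W. k x \<noteq> 0}" "\<forall>x\<in>W. k x \<noteq> 0 \<longrightarrow> G x = g x / k x"
    by (rule dual_meromorphic_local[OF assms(2), of l]) blast
  have "V \<inter> W \<subseteq> closure ({x\<in>V. h x \<noteq> 0} \<inter> {x\<in>W. k x \<noteq> 0})"
    using V(1,4,5) W(1,5) by (intro closure_Int_dense_open open_nonzero) auto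
  moreover have "{x\<in>V. h x \<noteq> 0} \<inter> {x\<in>W. k x \<noteq> 0} = {x\<in>V \<inter> W. h x * k x \<noteq> 0}" by auto
  ultimately show ?thesis
    using V W
    by (intro that[of "V \<inter> W" f h g k]) (auto intro: dual_holomorphic_on_subset)
qed

lemma dual_meromorphicI:
  assumes "\<And>l. \<exists>V g h. open V \<and> l \<in> V \<and> dual_holomorphic_on g V \<and> dual_holomorphic_on h V \<and>
    V \<subseteq> closure {x\<in>V. h x \<noteq> 0} \<and> (\<forall>x\<in>V. h x \<noteq> 0 \<longrightarrow> F x = g x / h x)"
  shows "dual_meromorphic F"
  using assms unfolding dual_meromorphic_def by blast

lemma dual_meromorphic_const: "dual_meromorphic (\<lambda>_. c)"
  by (rule dual_meromorphicI, rule exI[of _ UNIV], rule exI[of _ "\<lambda>_. c"], rule exI[of _ "\<lambda>_. 1"])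
     (simp add: dual_holomorphic_on_const)

lemma dual_meromorphic_add:
  assumes "dual_meromorphic F" "dual_meromorphic G"
  shows "dual_meromorphic (\<lambda>x. F x + G x)"
proof (rule dual_meromorphicI)
  fix l
  obtain V f h g k where V: "open V" "l \<in> V" "dual_holomorphic_on f V" "dual_holomorphic_on h V"
    "dual_holomorphic_on g V" "dual_holomorphic_on k V"
    "V \<subseteq> closure {x\<in>V. h x * k x \<noteq> 0}" "\<forall>x\<in>V. h x \<noteq> 0 \<longrightarrow> F x = f x / h x"
    "\<forall>x\<in>V. k x \<noteq> 0 \<longrightarrow> G x = g x / k x"
    by (rule dual_meromorphic_local2[OF assms, of l]) blast
  show "\<exists>V g h. open V \<and> l \<in> V \<and> dual_holomorphic_on g V \<and> dual_holomorphic_on h V \<and>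
      V \<subseteq> closure {x\<in>V. h x \<noteq> 0} \<and> (\<forall>x\<in>V. h x \<noteq> 0 \<longrightarrow> F x + G x = g x / h x)"
    by (rule exI[of _ V], rule exI[of _ "\<lambda>x. f x * k x + g x * h x"], rule exI[of _ "\<lambda>x. h x * k x"])
       (use V in \<open>auto intro!: dual_holomorphic_on_add dual_holomorphic_on_mult simp: field_simps\<close>)
qed

lemma dual_meromorphic_mult:
  assumes "dual_meromorphic F" "dual_meromorphic G"
  shows "dual_meromorphic (\<lambda>x. F x * G x)"
proof (rule dual_meromorphicI)
  fix l
  obtain V f h g k where V: "open V" "l \<in> V" "dual_holomorphic_on f V" "dual_holomorphic_on h V"
    "dual_holomorphic_on g V" "dual_holomorphic_on k V"
    "V \<subseteq> closure {x\<in>V. h x * k x \<noteq> 0}" "\<forall>x\<in>V. h x \<noteq> 0 \<longrightarrow> F x = f x / h x"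
    "\<forall>x\<in>V. k x \<noteq> 0 \<longrightarrow> G x = g x / k x"
    by (rule dual_meromorphic_local2[OF assms, of l]) blast
  show "\<exists>V g h. open V \<and> l \<in> V \<and> dual_holomorphic_on g V \<and> dual_holomorphic_on h V \<and>
      V \<subseteq> closure {x\<in>V. h x \<noteq> 0} \<and> (\<forall>x\<in>V. h x \<noteq> 0 \<longrightarrow> F x * G x = g x / h x)"
    by (rule exI[of _ V], rule exI[of _ "\<lambda>x. f x * g x"], rule exI[of _ "\<lambda>x. h x * k x"])
       (use V in \<open>auto intro!: dual_holomorphic_on_mult\<close>)
qed

lemma dir_deriv_cong:
  assumes "open S" "l \<in> S" "\<And>x. x \<in> S \<Longrightarrow> F x = G x"
  shows "dir_deriv m F l = dir_deriv m G l"
  unfolding dir_deriv_def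
proof (rule deriv_cong_ev)
  have "eventually (\<lambda>z. z \<in> {z. l + z *\<^sub>C m \<in> S}) (nhds 0)"
    using assms(2) by (intro eventually_nhds_in_open open_line assms(1)) simp
  then show "eventually (\<lambda>z. F (l + z *\<^sub>C m) = G (l + z *\<^sub>C m)) (nhds 0)"
    by eventually_elim (use assms(3) in auto)
qed simp

lemma eq_dense_open_dir_deriv:
  assumes "eq_dense_open F G"
  shows "eq_dense_open (dir_deriv m F) (dir_deriv m G)"
proof -
  obtain S where "open S" "closure S = UNIV" "\<forall>x\<in>S. F x = G x"
    using assms unfolding eq_dense_open_def by auto
  then show ?thesis
    unfolding eq_dense_open_def by (intro exI[of _ S]) (auto intro: dir_deriv_cong)
qed

lemma dual_meromorphic_dir_deriv:
  assumes "dual_meromorphic F"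
  shows "dual_meromorphic (dir_deriv m F)"
proof (rule dual_meromorphicI)
  fix l
  obtain V g h where V: "open V" "l \<in> V" "dual_holomorphic_on g V" "dual_holomorphic_on h V"
    "V \<subseteq> closure {x\<in>V. h x \<noteq> 0}" "\<forall>x\<in>V. h x \<noteq> 0 \<longrightarrow> F x = g x / h x"
    by (rule dual_meromorphic_local[OF assms, of l]) blast
  have D: "dir_deriv m F x = (dir_deriv m g x * h x - g x * dir_deriv m h x) / (h x * h x)"
    if "x \<in> V" "h x \<noteq> 0" for x
  proof -
    have "dir_deriv m F x = dir_deriv m (\<lambda>x. g x / h x) x"
      by (rule dir_deriv_cong[OF open_nonzero[OF V(1,4)]]) (use that V(6) in auto)
    also have "\<dots> = (dir_deriv m g x * h x - g x * dir_deriv m h x) / (h x * h x)"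
      unfolding dir_deriv_def[of m "\<lambda>x. g x / h x"]
      using DERIV_divide[OF dual_holomorphic_on_line_deriv[OF V(3), of x 0 m]
          dual_holomorphic_on_line_deriv[OF V(4), of x 0 m]] that
      by (intro DERIV_imp_deriv) simp
    finally show ?thesis .
  qed
  show "\<exists>V g h. open V \<and> l \<in> V \<and> dual_holomorphic_on g V \<and> dual_holomorphic_on h V \<and>
      V \<subseteq> closure {x\<in>V. h x \<noteq> 0} \<and> (\<forall>x\<in>V. h x \<noteq> 0 \<longrightarrow> dir_deriv m F x = g x / h x)"
    by (rule exI[of _ V], rule exI[of _ "\<lambda>x. dir_deriv m g x * h x - g x * dir_deriv m h x"],
        rule exI[of _ "\<lambda>x. h x * h x"])
       (use V D in \<open>auto intro!: dual_holomorphic_on_diff dual_holomorphic_on_mult dual_holomorphic_on_dir_deriv\<close>)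
qed

lemma mero_rel_part_equivp: "part_equivp mero_rel"
proof (rule part_equivpI)
  show "\<exists>F. mero_rel F F" by (rule exI[of _ "\<lambda>_. 0"]) (simp add: mero_rel_def dual_meromorphic_const)
  show "symp mero_rel" by (auto simp: symp_def mero_rel_def eq_dense_open_sym)
  show "transp mero_rel"
  proof (rule transpI)
    fix F G H assume "mero_rel F G" "mero_rel G H"
    then show "mero_rel F H"
      unfolding mero_rel_def using eq_dense_open_combine[of F G G H F H] by simp
  qed
qed

quotient_type (overloaded) 'v mero = "'v::complex_vector dual \<Rightarrow> complex" / partial: mero_rel
  by (rule mero_rel_part_equivp)

lemma mero_rel_eqI: "mero_rel F F \<Longrightarrow> F = G \<Longrightarrow> mero_rel F G" by simp

lemma mero_rel_combine:
  assumes "mero_rel F F'" "mero_rel G G'"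
  shows "mero_rel (\<lambda>x. F x + G x) (\<lambda>x. F' x + G' x)" "mero_rel (\<lambda>x. F x * G x) (\<lambda>x. F' x * G' x)"
proof -
  show "mero_rel (\<lambda>x. F x + G x) (\<lambda>x. F' x + G' x)"
    using assms unfolding mero_rel_def
    by (simp add: dual_meromorphic_add eq_dense_open_combine[of F F' G G'])
  show "mero_rel (\<lambda>x. F x * G x) (\<lambda>x. F' x * G' x)"
    using assms unfolding mero_rel_def
    by (simp add: dual_meromorphic_mult eq_dense_open_combine[of F F' G G'])
qed

lemma mero_rel_const: "mero_rel (\<lambda>_. c) (\<lambda>_. c)"
  by (simp add: mero_rel_def dual_meromorphic_const)

lemma mero_rel_scale: "mero_rel F F' \<Longrightarrow> mero_rel (\<lambda>x. c * F x) (\<lambda>x. c * F' x)"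
  by (rule mero_rel_combine(2)[OF mero_rel_const])

lemma mero_rel_uminus: "mero_rel F F' \<Longrightarrow> mero_rel (\<lambda>x. - F x) (\<lambda>x. - F' x)"
  using mero_rel_scale[of F F' "-1"] by simp

lemma mero_rel_diff: "mero_rel F F' \<Longrightarrow> mero_rel G G' \<Longrightarrow> mero_rel (\<lambda>x. F x - G x) (\<lambda>x. F' x - G' x)"
  using mero_rel_combine(1)[OF _ mero_rel_uminus, of F F' G G'] by simp

lemmas mero_rel_intros = mero_rel_combine mero_rel_const mero_rel_scale mero_rel_uminus mero_rel_diff

instantiation mero :: (complex_vector) "{comm_ring_1, complex_algebra_1}"
begin
lift_definition zero_mero :: "'a mero" is "\<lambda>_. 0" by (rule mero_rel_intros)
lift_definition one_mero :: "'a mero" is "\<lambda>_. 1" by (rule mero_rel_intros)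
lift_definition plus_mero :: "'a mero \<Rightarrow> 'a mero \<Rightarrow> 'a mero" is "\<lambda>F G x. F x + G x"
  by (rule mero_rel_intros)
lift_definition minus_mero :: "'a mero \<Rightarrow> 'a mero \<Rightarrow> 'a mero" is "\<lambda>F G x. F x - G x"
  by (rule mero_rel_intros)
lift_definition uminus_mero :: "'a mero \<Rightarrow> 'a mero" is "\<lambda>F x. - F x"
  by (rule mero_rel_intros)
lift_definition times_mero :: "'a mero \<Rightarrow> 'a mero \<Rightarrow> 'a mero" is "\<lambda>F G x. F x * G x"
  by (rule mero_rel_intros)
lift_definition scaleC_mero :: "complex \<Rightarrow> 'a mero \<Rightarrow> 'a mero" is "\<lambda>c F x. c * F x"
  by (rule mero_rel_intros)
instance
proof
  show "(0 :: 'a mero) \<noteq> 1"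
    by transfer (auto simp: mero_rel_def eq_dense_open_def)
qed (transfer, rule mero_rel_eqI,
    (intro mero_rel_intros; assumption), simp add: algebra_simps)+
end

lift_definition mero_deriv :: "'v::complex_vector dual \<Rightarrow> 'v mero \<Rightarrow> 'v mero" is dir_deriv
  by (simp add: mero_rel_def dual_meromorphic_dir_deriv eq_dense_open_dir_deriv)

lemma dual_meromorphic_differentiable:
  assumes "dual_meromorphic F" "dual_meromorphic G"
  obtains S where "open S" "closure S = UNIV"
    "\<forall>l\<in>S. \<forall>m. (\<lambda>z. F (l + z *\<^sub>C m)) field_differentiable at 0"
    "\<forall>l\<in>S. \<forall>m. (\<lambda>z. G (l + z *\<^sub>C m)) field_differentiable at 0"
proof -
  have quot: "(\<lambda>z. H (x + z *\<^sub>C m)) field_differentiable at 0"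
    if "open V" "dual_holomorphic_on f V" "dual_holomorphic_on h V" "x \<in> V" "h x \<noteq> 0"
      "\<forall>x\<in>V. h x \<noteq> 0 \<longrightarrow> H x = f x / h x" for V f h H x and m :: "'a dual"
  proof -
    have "((\<lambda>z. f (x + z *\<^sub>C m) / h (x + z *\<^sub>C m)) has_field_derivative
        (dir_deriv m f x * h x - f x * dir_deriv m h x) / (h x * h x)) (at 0)"
      using DERIV_divide[OF dual_holomorphic_on_line_deriv[OF that(2), of x 0 m]
          dual_holomorphic_on_line_deriv[OF that(3), of x 0 m]] that(4,5) by simp
    moreover have "open {z. x + z *\<^sub>C m \<in> {x\<in>V. h x \<noteq> 0}}"
      using that(1,3) by (intro open_line open_nonzero)
    ultimately have "((\<lambda>z. H (x + z *\<^sub>C m)) has_field_derivative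
        (dir_deriv m f x * h x - f x * dir_deriv m h x) / (h x * h x)) (at 0)"
      by (rule has_field_derivative_transform_within_open) (use that in auto)
    then show ?thesis unfolding field_differentiable_def by blast
  qed
  define D where "D = {l. \<forall>m. (\<lambda>z. F (l + z *\<^sub>C m)) field_differentiable at 0
      \<and> (\<lambda>z. G (l + z *\<^sub>C m)) field_differentiable at 0}"
  have "l \<in> closure (interior D)" for l
  proof -
    obtain V f h g k where V: "open V" "l \<in> V" "dual_holomorphic_on f V" "dual_holomorphic_on h V"
      "dual_holomorphic_on g V" "dual_holomorphic_on k V"
      "V \<subseteq> closure {x\<in>V. h x * k x \<noteq> 0}" "\<forall>x\<in>V. h x \<noteq> 0 \<longrightarrow> F x = f x / h x"
      "\<forall>x\<in>V. k x \<noteq> 0 \<longrightarrow> G x = g x / k x"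
      by (rule dual_meromorphic_local2[OF assms, of l]) blast
    have "{x\<in>V. h x * k x \<noteq> 0} \<subseteq> D"
      unfolding D_def using quot[OF V(1,3,4) _ _ V(8)] quot[OF V(1,5,6) _ _ V(9)] by auto
    moreover have "open {x\<in>V. h x * k x \<noteq> 0}"
      using V(1,4,6) by (intro open_nonzero dual_holomorphic_on_mult)
    ultimately have "{x\<in>V. h x * k x \<noteq> 0} \<subseteq> interior D" by (rule interior_maximal)
    then show ?thesis using closure_mono V(2,7) by blast
  qed
  then have dense: "closure (interior D) = UNIV" by auto
  have sub: "interior D \<subseteq> D" by (rule interior_subset)
  have "\<forall>l\<in>D. \<forall>m. (\<lambda>z. F (l + z *\<^sub>C m)) field_differentiable at 0"
    "\<forall>l\<in>D. \<forall>m. (\<lambda>z. G (l + z *\<^sub>C m)) field_differentiable at 0"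
    by (simp_all add: D_def)
  then show ?thesis
    using sub by (intro that[OF open_interior dense]) (meson subsetD)+
qed

lemma clinear_mero_deriv: "clinear (mero_deriv m)"
proof -
  have "mero_deriv m (F + G) = mero_deriv m F + mero_deriv m G" for F G
  proof (transfer fixing: m)
    fix F G :: "'a dual \<Rightarrow> complex" assume "mero_rel F F" "mero_rel G G"
    then have FG: "dual_meromorphic F" "dual_meromorphic G" by (auto simp: mero_rel_def)
    obtain S where S: "open S" "closure S = UNIV"
      "\<forall>l\<in>S. \<forall>m. (\<lambda>z. F (l + z *\<^sub>C m)) field_differentiable at 0"
      "\<forall>l\<in>S. \<forall>m. (\<lambda>z. G (l + z *\<^sub>C m)) field_differentiable at 0"
      by (rule dual_meromorphic_differentiable[OF FG]) blast
    have "eq_dense_open (dir_deriv m (\<lambda>x. F x + G x)) (\<lambda>x. dir_deriv m F x + dir_deriv m G x)"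
      unfolding eq_dense_open_def dir_deriv_def
      by (rule exI[of _ S]) (use S in auto)
    then show "mero_rel (dir_deriv m (\<lambda>x. F x + G x)) (\<lambda>x. dir_deriv m F x + dir_deriv m G x)"
      by (simp add: mero_rel_def FG dual_meromorphic_add dual_meromorphic_dir_deriv)
  qed
  moreover have "mero_deriv m (c *\<^sub>C F) = c *\<^sub>C mero_deriv m F" for c F
  proof (transfer fixing: m c)
    fix F :: "'a dual \<Rightarrow> complex" assume "mero_rel F F"
    then have F: "dual_meromorphic F" by (auto simp: mero_rel_def)
    obtain S where S: "open S" "closure S = UNIV"
      "\<forall>l\<in>S. \<forall>m. (\<lambda>z. F (l + z *\<^sub>C m)) field_differentiable at 0"
      by (rule dual_meromorphic_differentiable[OF F F]) blast
    have "eq_dense_open (dir_deriv m (\<lambda>x. c * F x)) (\<lambda>x. c * dir_deriv m F x)"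
      unfolding eq_dense_open_def dir_deriv_def
      by (rule exI[of _ S]) (use S in auto)
    then show "mero_rel (dir_deriv m (\<lambda>x. c * F x)) (\<lambda>x. c * dir_deriv m F x)"
      by (simp add: mero_rel_def F dual_meromorphic_mult dual_meromorphic_const dual_meromorphic_dir_deriv)
  qed
  ultimately show ?thesis by (simp add: clinear_iff)
qed


section \<open>Meromorphic functions with values in an algebra\<close>

type_synonym ('v, 'b) mer_fun = "('v mero, 'b) tensor"

definition mer_const :: "'b::complex_algebra_1 \<Rightarrow> ('v::complex_vector, 'b) mer_fun"
  where "mer_const b = 1 \<otimes>\<^sub>C b"

definition mer_map :: "('b::complex_vector \<Rightarrow> 'c::complex_vector)
    \<Rightarrow> ('v::complex_vector, 'b) mer_fun \<Rightarrow> ('v, 'c) mer_fun"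
  where "mer_map L = tensor_lift (\<lambda>F b. F \<otimes>\<^sub>C L b)"

definition mer_deriv :: "'v::complex_vector dual \<Rightarrow> ('v, 'b::complex_vector) mer_fun \<Rightarrow> ('v, 'b) mer_fun"
  where "mer_deriv l = tensor_lift (\<lambda>F b. mero_deriv l F \<otimes>\<^sub>C b)"

lemma cbilinear_mer_map: "clinear L \<Longrightarrow> cbilinear (\<lambda>F b. F \<otimes>\<^sub>C L b)"
  using clinear_pure_tensor clinear_compose[of L] by (auto simp: cbilinear_def)

lemma cbilinear_mer_deriv: "cbilinear (\<lambda>F b. mero_deriv l F \<otimes>\<^sub>C b)"
  using clinear_pure_tensor clinear_compose[OF clinear_mero_deriv] by (auto simp: cbilinear_def)

lemma mer_map_pure: "clinear L \<Longrightarrow> mer_map L (F \<otimes>\<^sub>C b) = F \<otimes>\<^sub>C L b"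
  by (simp add: mer_map_def cbilinear_mer_map)

lemma clinear_mer_map: "clinear L \<Longrightarrow> clinear (mer_map L)"
  by (simp add: mer_map_def cbilinear_mer_map clinear_tensor_lift)

lemma mer_deriv_pure: "mer_deriv l (F \<otimes>\<^sub>C b) = mero_deriv l F \<otimes>\<^sub>C b"
  by (simp add: mer_deriv_def cbilinear_mer_deriv)

lemma clinear_mer_deriv: "clinear (mer_deriv l)"
  by (simp add: mer_deriv_def cbilinear_mer_deriv clinear_tensor_lift)


section \<open>Automorphisms, parametrised subspaces and dual bases\<close>

definition algebra_automorphism :: "('u::complex_algebra_1 \<Rightarrow> 'u) \<Rightarrow> bool"
  where "algebra_automorphism \<theta> \<longleftrightarrow>
    clinear \<theta> \<and> bij \<theta> \<and> (\<forall>x y. \<theta> (x * y) = \<theta> x * \<theta> y) \<and> \<theta> 1 = 1"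

definition eigenspace :: "('u::complex_vector \<Rightarrow> 'u) \<Rightarrow> complex \<Rightarrow> 'u set"
  where "eigenspace \<theta> c = {u. \<theta> u = c *\<^sub>C u}"

(* HOL has no types depending on terms, so a subspace a of 'u that is to be dualised is given together
   with a linear isomorphism j from a type 'v onto it; 'v dual is then the dual space of a. *)
definition parametrises :: "('v::complex_vector \<Rightarrow> 'u::complex_vector) \<Rightarrow> 'u set \<Rightarrow> bool"
  where "parametrises j a \<longleftrightarrow> clinear j \<and> inj j \<and> range j = a"

definition basis_of :: "nat \<Rightarrow> (nat \<Rightarrow> 'u::complex_vector) \<Rightarrow> 'u set \<Rightarrow> bool"
  where "basis_of d x a \<longleftrightarrow>
    inj_on x {1..d} \<and> cvec.independent (x ` {1..d}) \<and> cvec.span (x ` {1..d}) = a"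

definition dual_basis_of ::
    "nat \<Rightarrow> ('v::complex_vector \<Rightarrow> 'u::complex_vector) \<Rightarrow> (nat \<Rightarrow> 'u) \<Rightarrow> (nat \<Rightarrow> 'v dual) \<Rightarrow> bool"
  where "dual_basis_of d j x lam \<longleftrightarrow>
    (\<forall>k\<in>{1..d}. \<forall>l\<in>{1..d}. dual_apply (lam k) (inv j (x l)) = (if k = l then 1 else 0))"


section \<open>The dynamical Yang-Baxter expressions\<close>

definition commutator :: "'b::ring \<Rightarrow> 'b \<Rightarrow> 'b"
  where "commutator y z = y * z - z * y"

definition legs :: "'n::finite \<Rightarrow> 'n \<Rightarrow> ('v::complex_vector, ('u::complex_algebra_1, 2) tpow) mer_fun
    \<Rightarrow> ('v, ('u, 'n) tpow) mer_fun"
  where "legs i j = mer_map (tpow_legs (\<lambda>k :: 2. if k = 1 then i else j))"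

definition dyn_E :: "nat \<Rightarrow> (nat \<Rightarrow> 'u::complex_algebra_1) \<Rightarrow> (nat \<Rightarrow> 'v::complex_vector dual)
    \<Rightarrow> 'n::finite \<Rightarrow> ('v, ('u, 'n) tpow) mer_fun \<Rightarrow> ('v, ('u, 'n) tpow) mer_fun"
  where "dyn_E d x lam i f = (\<Sum>k=1..d. mer_const (tpow_at i (x k)) * mer_deriv (lam k) f)"

definition theta_left :: "('u::complex_algebra_1 \<Rightarrow> 'u) \<Rightarrow> ('v::complex_vector, ('u, 2) tpow) mer_fun
    \<Rightarrow> ('v, ('u, 2) tpow) mer_fun"
  where "theta_left \<theta> = mer_map (tpow_map (\<lambda>k. if k = 1 then \<theta> else id))"

context
  fixes d :: nat and x :: "nat \<Rightarrow> 'u::complex_algebra_1" and lam :: "nat \<Rightarrow> 'v::complex_vector dual"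
begin

definition YB :: "('v, ('u, 2) tpow) mer_fun \<Rightarrow> ('v, ('u, 3) tpow) mer_fun"
  where "YB r =
    commutator (legs 1 2 r) (legs 1 3 r) + commutator (legs 1 2 r) (legs 2 3 r)
    + commutator (legs 1 3 r) (legs 2 3 r)
    + dyn_E d x lam 1 (legs 2 3 r) - dyn_E d x lam 2 (legs 1 3 r) + dyn_E d x lam 3 (legs 1 2 r)"

definition CYB1 :: "('v, ('u, 2) tpow) mer_fun \<Rightarrow> ('v, ('u, 2) tpow) mer_fun \<Rightarrow> ('v, ('u, 3) tpow) mer_fun"
  where "CYB1 rp rm =
    commutator (legs 1 2 rp) (legs 1 3 rp) + commutator (legs 1 2 rp) (legs 2 3 rp)
    - commutator (legs 1 3 rp) (legs 2 3 rm)
    + dyn_E d x lam 3 (legs 1 2 rp) - dyn_E d x lam 2 (legs 1 3 rp)"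

definition CYB2 :: "('v, ('u, 2) tpow) mer_fun \<Rightarrow> ('v, ('u, 2) tpow) mer_fun \<Rightarrow> ('v, ('u, 3) tpow) mer_fun"
  where "CYB2 rp rm =
    commutator (legs 1 2 rm) (legs 1 3 rp) + commutator (legs 1 2 rm) (legs 2 3 rp)
    + commutator (legs 1 3 rm) (legs 2 3 rp)
    + dyn_E d x lam 3 (legs 1 2 rm) - dyn_E d x lam 1 (legs 2 3 rp)"

definition CYB3 :: "('v, ('u, 2) tpow) mer_fun \<Rightarrow> ('v, ('u, 2) tpow) mer_fun \<Rightarrow> ('v, ('u, 3) tpow) mer_fun"
  where "CYB3 rp rm =
    - commutator (legs 1 2 rp) (legs 1 3 rm) + commutator (legs 1 2 rm) (legs 2 3 rm)
    + commutator (legs 1 3 rm) (legs 2 3 rm)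
    + dyn_E d x lam 2 (legs 1 3 rm) - dyn_E d x lam 1 (legs 2 3 rm)"

end

definition CYB :: "('v::complex_vector, ('u::complex_algebra_1, 2) tpow) mer_fun
    \<Rightarrow> ('v, ('u, 2) tpow) mer_fun \<Rightarrow> ('v, ('u, 3) tpow) mer_fun"
  where "CYB rp rm =
    commutator (legs 1 2 rm) (legs 1 3 rm) - commutator (legs 1 2 rp) (legs 2 3 rm)
    + commutator (legs 1 3 rp) (legs 2 3 rp)"

definition dynamical_r_matrix :: "nat \<Rightarrow> (nat \<Rightarrow> 'u::complex_algebra_1) \<Rightarrow> (nat \<Rightarrow> 'v::complex_vector dual)
    \<Rightarrow> ('v, ('u, 2) tpow) mer_fun \<Rightarrow> bool"
  where "dynamical_r_matrix d x lam r \<longleftrightarrow> YB d x lam r = 0"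

definition dynamical_r_matrix_pair :: "nat \<Rightarrow> (nat \<Rightarrow> 'u::complex_algebra_1) \<Rightarrow> (nat \<Rightarrow> 'v::complex_vector dual)
    \<Rightarrow> ('v, ('u, 2) tpow) mer_fun \<Rightarrow> ('v, ('u, 2) tpow) mer_fun \<Rightarrow> bool"
  where "dynamical_r_matrix_pair d x lam rp rm \<longleftrightarrow>
    CYB1 d x lam rp rm = 0 \<and> CYB2 d x lam rp rm = 0 \<and> CYB3 d x lam rp rm = 0"

end

theory Submission
  imports Defs
begin

text \<open>
  Write \<open>r = r\<^sup>+ - r\<^sup>-\<close> and \<open>rt = r\<^sup>+ + r\<^sup>-\<close>. Expanding brackets,
  \<open>YB(r) = CYB[1] - CYB[2] + CYB[3] + CYB\<close>, which gives one implication. Conversely, let \<open>T\<close> be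
  the flip of the first two legs of \<open>U \<otimes> U \<otimes> U\<close> followed by \<open>\<theta>\<close> on both of them. Twisted symmetry
  says that \<open>T\<close> fixes \<open>r\<^sub>1\<^sub>2\<close> and maps \<open>r\<^sub>1\<^sub>3\<close> to \<open>rt\<^sub>2\<^sub>3\<close> and \<open>r\<^sub>2\<^sub>3\<close> to \<open>rt\<^sub>1\<^sub>3\<close>, and
  since \<open>\<theta> = -1\<close> on \<open>\<aa>\<close> it turns \<open>E\<^sub>1\<close> into \<open>-E\<^sub>2\<close> and \<open>E\<^sub>2\<close> into \<open>-E\<^sub>1\<close>. This yields
  \<open>YB(r) + T YB(r) = 2 (CYB[1] - CYB[2])\<close>. Finally \<open>\<theta>\<close> on the first leg fixes \<open>CYB[1]\<close> and
  \<open>CYB\<close> and negates \<open>CYB[2]\<close> and \<open>CYB[3]\<close>, so \<open>YB(r) = 0\<close> first forces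
  \<open>CYB[1] = CYB[2] = 0\<close> and then \<open>CYB[3] = CYB = 0\<close>.
\<close>

text \<open>Preservation of \<open>1\<close> belongs to the notion because leg maps pad the
  remaining positions with \<open>1\<close>.\<close>

definition alg_hom :: "('a::complex_algebra_1 \<Rightarrow> 'b::complex_algebra_1) \<Rightarrow> bool"
  where "alg_hom h \<longleftrightarrow> clinear h \<and> (\<forall>x y. h (x * y) = h x * h y) \<and> h 1 = 1"

lemma alg_homD:
  assumes "alg_hom h"
  shows "clinear h" and "h (x * y) = h x * h y" and "h 1 = 1"
  using assms by (auto simp: alg_hom_def)

lemma alg_hom_id: "alg_hom id"
  by (simp add: alg_hom_def clinear_iff)

lemma clinear_id: "clinear id"
  by (simp add: clinear_iff)

text \<open>The scalar 2 is invertible. This cancels the doubling in \<open>Y + T Y\<close> and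
  turns \<open>b = - b\<close> into \<open>b = 0\<close>.\<close>

lemma add_self_eq_0_iff: "x + x = 0 \<longleftrightarrow> x = (0 :: 'a::complex_vector)"
proof
  assume "x + x = 0"
  then have "2 *\<^sub>C x = 0" by (metis one_add_one scaleC_add_left scaleC_one)
  then show "x = 0" by simp
qed simp

text \<open>\<open>P\<close> stands for the pure tensors, which determine linear maps by
  \<open>ext\<close>. Multiplicativity spreads from \<open>P\<close> first in the right factor, then
  in the left one. Keeping \<open>P\<close> abstract serves both \<open>tpow\<close> and
  \<open>tensor\<close>.\<close>

lemma linear_mult_ext:
  fixes L :: "'a::complex_algebra_1 \<Rightarrow> 'b::complex_algebra_1"
  assumes L: "clinear L"
    and ext: "\<And>F G :: 'a \<Rightarrow> 'b. clinear F \<Longrightarrow> clinear G \<Longrightarrow> (\<And>p. p \<in> P \<Longrightarrow> F p = G p) \<Longrightarrow> F = G"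
    and P: "\<And>p q. p \<in> P \<Longrightarrow> q \<in> P \<Longrightarrow> L (p * q) = L p * L q"
  shows "L (s * t) = L s * L t"
proof -
  have 1: "(\<lambda>t. L (p * t)) = (\<lambda>t. L p * L t)" if "p \<in> P" for p
    by (rule ext) (use that P L clinear_compose[OF clinear_mult_right L]
        clinear_compose[OF L clinear_mult_right] in auto)
  have "(\<lambda>s. L (s * t)) = (\<lambda>s. L s * L t)"
    by (rule ext) (use 1 L clinear_compose[OF clinear_mult_left L]
        clinear_compose[OF L clinear_mult_left] in \<open>auto dest: fun_cong\<close>)
  then show ?thesis by (rule fun_cong)
qed


section \<open>Maps between tensor powers\<close>

lemma alg_hom_tpow_map:
  fixes g :: "'n::finite \<Rightarrow> 'u::complex_algebra_1 \<Rightarrow> 'w::complex_algebra_1"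
  assumes g: "\<And>i. alg_hom (g i)"
  shows "alg_hom (tpow_map g)"
proof -
  note [simp] = tpow_map_pure(1)[of g, OF alg_homD(1)[OF g]] alg_homD(2,3)[OF g] mult_pure_tpow
  have lin: "clinear (tpow_map g)"
    by (rule tpow_map_pure(2)) (rule alg_homD(1)[OF g])
  have "tpow_map g (s * t) = tpow_map g s * tpow_map g t" for s t
  proof (rule linear_mult_ext[OF lin, of "range pure_tpow"])
    show "F = G" if "clinear F" "clinear G" "\<And>p. p \<in> range pure_tpow \<Longrightarrow> F p = G p"
      for F G :: "('u, 'n) tpow \<Rightarrow> ('w, 'n) tpow"
      by (rule ext) (rule tpow_ext, use that in auto)
  qed auto
  then show ?thesis by (simp add: alg_hom_def lin one_tpow_def)
qed

lemma alg_hom_tpow_legs: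
  fixes i :: "'k::finite \<Rightarrow> 'n::finite"
  assumes i: "inj i"
  shows "alg_hom (tpow_legs i :: ('u::complex_algebra_1, 'k) tpow \<Rightarrow> ('u, 'n) tpow)"
proof -
  let ?L = "tpow_legs i :: ('u, 'k) tpow \<Rightarrow> ('u, 'n) tpow"
  note [simp] = tpow_legs_pure(1)[OF i] mult_pure_tpow
  have lin: "clinear ?L" by (rule tpow_legs_pure(2)[OF i])
  have "?L (s * t) = ?L s * ?L t" for s t
  proof (rule linear_mult_ext[OF lin, of "range pure_tpow"])
    show "F = G" if "clinear F" "clinear G" "\<And>p. p \<in> range pure_tpow \<Longrightarrow> F p = G p"
      for F G :: "('u, 'k) tpow \<Rightarrow> ('u, 'n) tpow"
      by (rule ext) (rule tpow_ext, use that in auto)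
  qed (auto simp: fun_eq_iff intro!: arg_cong[where f = pure_tpow])
  moreover have "?L 1 = 1" by (simp add: one_tpow_def cong: if_cong)
  ultimately show ?thesis by (simp add: alg_hom_def lin)
qed

lemma tpow_map_id: "tpow_map (\<lambda>_. id) t = t"
  by (rule tpow_ext) (simp_all add: tpow_map_pure clinear_id clinear_id[unfolded id_def])

lemma tpow_map_map:
  assumes "\<And>i. clinear (g i)" "\<And>i. clinear (h i)"
  shows "tpow_map g (tpow_map h t) = tpow_map (\<lambda>i. g i \<circ> h i) t"
proof (rule tpow_ext[of "\<lambda>t. tpow_map g (tpow_map h t)"])
  have gh: "clinear (g i \<circ> h i)" for i
    using clinear_compose[OF assms(2,1)] by (simp add: comp_def)
  show "clinear (\<lambda>t. tpow_map g (tpow_map h t))"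
    by (rule clinear_compose; rule tpow_map_pure(2); fact assms)
  show "clinear (tpow_map (\<lambda>i. g i \<circ> h i))" by (intro tpow_map_pure(2) gh)
  show "tpow_map g (tpow_map h (pure_tpow u)) = tpow_map (\<lambda>i. g i \<circ> h i) (pure_tpow u)" for u
    by (simp add: tpow_map_pure assms gh)
qed

lemma tpow_legs_legs:
  assumes "inj i" "inj \<pi>"
  shows "tpow_legs \<pi> (tpow_legs i t) = tpow_legs (\<pi> \<circ> i) t"
proof (rule tpow_ext[of "\<lambda>t. tpow_legs \<pi> (tpow_legs i t)"])
  have \<pi>i: "inj (\<pi> \<circ> i)" using assms by (rule inj_compose[rotated])
  show "clinear (\<lambda>t. tpow_legs \<pi> (tpow_legs i t))"
    by (rule clinear_compose; rule tpow_legs_pure(2); fact assms)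
  show "clinear (tpow_legs (\<pi> \<circ> i))" by (intro tpow_legs_pure(2) \<pi>i)
  show "tpow_legs \<pi> (tpow_legs i (pure_tpow u)) = tpow_legs (\<pi> \<circ> i) (pure_tpow u)" for u
  proof -
    \<comment> \<open>Off \<open>range (\<pi> \<circ> i)\<close> both sides are \<open>1\<close>:
      either padding by \<open>\<pi>\<close>, or padding by \<open>i\<close> carried along.\<close>
    have "(if m \<in> range \<pi> then if inv \<pi> m \<in> range i then u (inv i (inv \<pi> m)) else 1 else 1)
        = (if m \<in> range (\<pi> \<circ> i) then u (inv (\<pi> \<circ> i) m) else 1)" for m
    proof (cases "m \<in> range (\<pi> \<circ> i)")
      case True
      then obtain k where "m = (\<pi> \<circ> i) k" by blast
      then show ?thesis using inv_f_f[OF \<pi>i, of k] assms by simp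
    next
      case False
      then show ?thesis using assms by auto
    qed
    then show ?thesis by (simp add: tpow_legs_pure assms \<pi>i)
  qed
qed

lemma tpow_legs_id: "tpow_legs id t = t"
  by (rule tpow_ext) (simp_all add: tpow_legs_pure clinear_iff tpow_legs_pure(2)[unfolded clinear_iff])

text \<open>A position outside \<open>range i\<close> carries \<open>1\<close>, which
  \<open>g m\<close> fixes, so only the maps \<open>g \<circ> i\<close> matter.\<close>

lemma tpow_map_legs:
  assumes i: "inj i" and g: "\<And>m. alg_hom (g m)"
  shows "tpow_map g (tpow_legs i t) = tpow_legs i (tpow_map (g \<circ> i) t)"
proof (rule tpow_ext[of "\<lambda>t. tpow_map g (tpow_legs i t)"])
  note lin = alg_homD(1)[OF g]
  show "clinear (\<lambda>t. tpow_map g (tpow_legs i t))"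
    "clinear (\<lambda>t. tpow_legs i (tpow_map (g \<circ> i) t))"
    by (rule clinear_compose; (rule tpow_legs_pure(2)[OF i] tpow_map_pure(2)); simp add: lin)+
  show "tpow_map g (tpow_legs i (pure_tpow u)) = tpow_legs i (tpow_map (g \<circ> i) (pure_tpow u))" for u
    using i by (auto simp: tpow_legs_pure tpow_map_pure lin alg_homD(3)[OF g] fun_eq_iff
        intro!: arg_cong[where f = pure_tpow])
qed

lemma tpow_legs_at:
  assumes "inj \<pi>"
  shows "tpow_legs \<pi> (tpow_at i x) = tpow_at (\<pi> i) x"
  using assms by (auto simp: tpow_at_def tpow_legs_pure fun_eq_iff intro!: arg_cong[where f = pure_tpow])

lemma tpow_map_at:
  assumes "\<And>m. alg_hom (g m)"
  shows "tpow_map g (tpow_at i x) = tpow_at i (g i x)"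
  by (auto simp: tpow_at_def tpow_map_pure alg_homD[OF assms] fun_eq_iff intro!: arg_cong[where f = pure_tpow])

lemma clinear_tpow_at:
  "clinear (tpow_at i :: 'u::complex_algebra_1 \<Rightarrow> ('u, 'n::finite) tpow)"
proof -
  \<comment> \<open>Updating the constant family \<open>1\<close> at \<open>i\<close> exposes the
    linearity of \<open>pure_tpow\<close> in slot \<open>i\<close>.\<close>
  have "tpow_at i = (\<lambda>x :: 'u. pure_tpow ((\<lambda>_. 1)(i := x)))"
    by (auto simp: tpow_at_def intro!: ext arg_cong[where f = pure_tpow])
  then show ?thesis using clinear_pure_tpow[rule_format, of "\<lambda>_. 1" i] by (simp only:)
qed


section \<open>Pointwise application to meromorphic functions\<close>

lemma mer_map_id: "mer_map id f = f"
  by (rule tensor_ext) (simp_all add: clinear_mer_map mer_map_pure clinear_id clinear_id[unfolded id_def])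

lemma mer_map_map:
  assumes "clinear K" "clinear L"
  shows "mer_map K (mer_map L f) = mer_map (K \<circ> L) f"
proof -
  have KL: "clinear (K \<circ> L)"
    using clinear_compose[OF assms(2,1)] by (simp add: comp_def)
  show ?thesis
    by (rule tensor_ext[of "\<lambda>f. mer_map K (mer_map L f)"])
       (simp_all add: clinear_compose clinear_mer_map mer_map_pure assms KL)
qed

lemma mer_map_deriv:
  assumes "clinear L"
  shows "mer_map L (mer_deriv l f) = mer_deriv l (mer_map L f)"
  by (rule tensor_ext[of "\<lambda>f. mer_map L (mer_deriv l f)"])
     (simp_all add: clinear_compose clinear_mer_map clinear_mer_deriv mer_map_pure mer_deriv_pure assms)

lemma mer_map_mult:
  assumes L: "alg_hom L"
  shows "mer_map L (f * g) = mer_map L f * mer_map L g"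
proof (rule linear_mult_ext[OF clinear_mer_map, of _ "range (case_prod (\<otimes>\<^sub>C))"])
  show "F = G" if "clinear F" "clinear G" "\<And>p. p \<in> range (case_prod (\<otimes>\<^sub>C)) \<Longrightarrow> F p = G p"
    for F G :: "('c, 'a) mer_fun \<Rightarrow> ('c, 'b) mer_fun"
    by (rule ext) (rule tensor_ext, use that in auto)
qed (auto simp: mult_pure_tensor mer_map_pure alg_homD[OF L])

lemma mer_map_commutator:
  assumes "alg_hom L"
  shows "mer_map L (commutator f g) = commutator (mer_map L f) (mer_map L g)"
  by (simp add: commutator_def clinear_diff[OF clinear_mer_map[OF alg_homD(1)[OF assms]]]
      mer_map_mult assms)

lemma mer_map_const: "clinear L \<Longrightarrow> mer_map L (mer_const b) = mer_const (L b)"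
  by (simp add: mer_const_def mer_map_pure)

lemma mer_const_minus: "mer_const (- b) = - mer_const b"
  unfolding mer_const_def using clinear_pure_tensor by (intro clinear_minus) auto

lemma inj_pair: "i \<noteq> j \<Longrightarrow> inj (\<lambda>k :: 2. if k = 1 then i else j)"
  by (rule injI) (metis (full_types) exhaust_2)

lemma clinear_legs: "i \<noteq> j \<Longrightarrow> clinear (legs i j)"
  unfolding legs_def by (intro clinear_mer_map tpow_legs_pure(2) inj_pair)

lemma clinear_dyn_E: "clinear (dyn_E d x lam i)"
  by (simp add: clinear_iff dyn_E_def clinear_mer_deriv[unfolded clinear_iff] distrib_left
      mult_scaleC_right sum.distrib cvec.scale_sum_right)


section \<open>Permuting the legs and twisting them by algebra endomorphisms\<close>

text \<open>Components move along \<open>\<pi>\<close> first and meet \<open>g\<close> at their new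
  position; hence \<open>g (\<pi> i)\<close> rather than \<open>g i\<close> below.\<close>

definition twist :: "('n::finite \<Rightarrow> 'u::complex_algebra_1 \<Rightarrow> 'u) \<Rightarrow> ('n \<Rightarrow> 'n)
    \<Rightarrow> ('v::complex_vector, ('u, 'n) tpow) mer_fun \<Rightarrow> ('v, ('u, 'n) tpow) mer_fun"
  where "twist g \<pi> = mer_map (tpow_map g \<circ> tpow_legs \<pi>)"

context
  fixes g :: "'n::finite \<Rightarrow> 'u::complex_algebra_1 \<Rightarrow> 'u" and \<pi> :: "'n \<Rightarrow> 'n"
  assumes g: "\<And>i. alg_hom (g i)" and \<pi>: "inj \<pi>"
begin

lemma alg_hom_twist: "alg_hom (tpow_map g \<circ> tpow_legs \<pi>)"
  using alg_hom_tpow_map[of g, OF g] alg_hom_tpow_legs[OF \<pi>, where 'u = 'u]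
  by (auto simp: alg_hom_def clinear_iff)

lemma clinear_twist: "clinear (twist g \<pi>)"
  unfolding twist_def by (rule clinear_mer_map[OF alg_homD(1)[OF alg_hom_twist]])

lemma twist_commutator: "twist g \<pi> (commutator a b) = commutator (twist g \<pi> a) (twist g \<pi> b)"
  unfolding twist_def by (rule mer_map_commutator[OF alg_hom_twist])

text \<open>Pushing \<open>tpow_map g\<close> inside the leg map leaves a twist of two tensor
  factors, where the symmetry of \<open>r\<close> can be used.\<close>

lemma twist_legs:
  assumes "i \<noteq> j"
  shows "twist g \<pi> (legs i j f)
    = legs (\<pi> i) (\<pi> j) (mer_map (tpow_map (\<lambda>k. if k = 1 then g (\<pi> i) else g (\<pi> j))) f)"
proof -
  let ?s = "\<lambda>k :: 2. if k = 1 then i else j"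
  let ?t = "\<lambda>k :: 2. if k = 1 then \<pi> i else \<pi> j"
  let ?h = "\<lambda>k :: 2. if k = 1 then g (\<pi> i) else g (\<pi> j)"
  have s: "inj ?s" and t: "inj ?t" using assms \<pi> by (auto intro!: inj_pair dest: injD)
  have eq: "\<pi> \<circ> ?s = ?t" "g \<circ> ?t = ?h" by (simp_all add: fun_eq_iff)
  have h: "clinear (tpow_map ?h)" by (rule tpow_map_pure(2)) (simp add: alg_homD[OF g])
  have "tpow_map g \<circ> tpow_legs \<pi> \<circ> tpow_legs ?s = tpow_legs ?t \<circ> tpow_map ?h"
    using tpow_map_legs[of ?t g, OF t g] by (simp add: fun_eq_iff tpow_legs_legs[OF s \<pi>] eq)
  then show ?thesis
    unfolding twist_def legs_def
    by (simp only: mer_map_map[OF alg_homD(1)[OF alg_hom_twist] tpow_legs_pure(2)[OF s]]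
      mer_map_map[OF tpow_legs_pure(2)[OF t] h])
qed

text \<open>The twist acts only on the algebra factor, so it commutes with \<open>mer_deriv\<close>;
  being multiplicative, it carries the coefficient \<open>x k\<close> to position
  \<open>\<pi> i\<close>, where \<open>g\<close> fixes it.\<close>

lemma twist_dyn_E:
  assumes "\<And>k. k \<in> {1..d} \<Longrightarrow> g (\<pi> i) (x k) = x k"
  shows "twist g \<pi> (dyn_E d x lam i f) = dyn_E d x lam (\<pi> i) (twist g \<pi> f)"
  unfolding dyn_E_def clinear_sum[OF clinear_twist]
  by (rule sum.cong) (simp_all add: twist_def mer_map_mult[OF alg_hom_twist]
      mer_map_deriv[OF alg_homD(1)[OF alg_hom_twist]] mer_map_const[OF alg_homD(1)[OF alg_hom_twist]]
      tpow_legs_at[OF \<pi>] tpow_map_at[of g, OF g] assms)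

text \<open>Now the moved coefficient changes sign, as elements of \<open>\<aa>\<close> do under
  \<theta>.\<close>

lemma twist_dyn_E_neg:
  assumes "\<And>k. k \<in> {1..d} \<Longrightarrow> g (\<pi> i) (x k) = - x k"
  shows "twist g \<pi> (dyn_E d x lam i f) = - dyn_E d x lam (\<pi> i) (twist g \<pi> f)"
  unfolding dyn_E_def clinear_sum[OF clinear_twist] sum_negf[symmetric]
  by (rule sum.cong) (simp_all add: twist_def mer_map_mult[OF alg_hom_twist]
      mer_map_deriv[OF alg_homD(1)[OF alg_hom_twist]] mer_map_const[OF alg_homD(1)[OF alg_hom_twist]]
      tpow_legs_at[OF \<pi>] tpow_map_at[of g, OF g] assms clinear_minus[OF clinear_tpow_at] mer_const_minus)

end

lemma twist_perm_id: "twist g id f = mer_map (tpow_map g) f"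
  by (simp add: twist_def comp_def tpow_legs_id)

lemma legs_legs:
  assumes "i \<noteq> j"
  shows "legs i j (legs 2 1 f) = legs j i f"
proof -
  have *: "(\<lambda>k :: 2. if k = 1 then i else j) \<circ> (\<lambda>k :: 2. if k = 1 then 2 else 1)
      = (\<lambda>k :: 2. if k = 1 then j else i)"
    by (auto simp: fun_eq_iff)
  have inj: "inj (\<lambda>k :: 2. if k = 1 then i else j)" "inj (\<lambda>k :: 2. if k = 1 then (2 :: 2) else 1)"
    by (rule inj_pair, use assms in simp)+
  show ?thesis
    unfolding legs_def mer_map_map[OF tpow_legs_pure(2)[OF inj(1)] tpow_legs_pure(2)[OF inj(2)]]
    by (simp add: comp_def tpow_legs_legs[OF inj(2,1)] *[unfolded comp_def])
qed

theorem theorem5p4: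
  fixes \<theta> :: "'u::complex_algebra_1 \<Rightarrow> 'u"
    and \<aa> :: "'u set"
    and j :: "'v::complex_vector \<Rightarrow> 'u"
    and d :: nat and x :: "nat \<Rightarrow> 'u" and lam :: "nat \<Rightarrow> 'v dual"
    and r rt rp rm :: "('v, ('u, 2) tpow) mer_fun"
  assumes "algebra_automorphism \<theta>" and "\<theta> \<circ> \<theta> = id"
    and "cvec.subspace \<aa>" and "\<aa> \<subseteq> eigenspace \<theta> (-1)"
    and "parametrises j \<aa>"
    and "basis_of d x \<aa>" and "dual_basis_of d j x lam"
    and "rt = theta_left \<theta> r" and "legs 2 1 rt = rt"
    and "rp = (1/2) *\<^sub>C (rt + r)" and "rm = (1/2) *\<^sub>C (rt - r)"
  shows "dynamical_r_matrix d x lam r \<longleftrightarrow>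
    dynamical_r_matrix_pair d x lam rp rm \<and> CYB rp rm = 0"
proof -
  have th: "alg_hom \<theta>" and th2: "\<theta> (\<theta> u) = u" for u
    using assms(1) fun_cong[OF assms(2), of u] by (auto simp: algebra_automorphism_def alg_hom_def)
  have thx: "\<theta> (x k) = - x k" if "k \<in> {1..d}" for k
  proof -
    have "x k \<in> cvec.span (x ` {1..d})" using that by (intro cvec.span_base) auto
    then show ?thesis
      using assms(4,6) by (auto simp: basis_of_def eigenspace_def)
  qed
  let ?tl = "\<lambda>k :: 2. if k = 1 then \<theta> else id"
  have mtl: "mer_map (tpow_map ?tl) = theta_left \<theta>" by (simp add: theta_left_def)
  have mid: "mer_map (tpow_map (\<lambda>_ :: 2. id)) f = f" for f :: "('v, ('u, 2) tpow) mer_fun"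
  proof -
    have "tpow_map (\<lambda>_ :: 2. id) = (id :: ('u, 2) tpow \<Rightarrow> _)" by (auto simp: tpow_map_id)
    then show ?thesis by (simp add: mer_map_id)
  qed
  have tl: "clinear (tpow_map ?tl)" by (rule tpow_map_pure(2)) (simp add: alg_homD[OF th] clinear_id)
  have lin: "clinear (theta_left \<theta> :: ('v, ('u, 2) tpow) mer_fun \<Rightarrow> _)"
    unfolding theta_left_def by (rule clinear_mer_map[OF tl])
  have inv: "theta_left \<theta> rt = r"
  proof -
    have "tpow_map ?tl \<circ> tpow_map ?tl = (id :: ('u, 2) tpow \<Rightarrow> _)"
    proof
      fix t :: "('u, 2) tpow"
      have "(\<lambda>i. ?tl i \<circ> ?tl i) = (\<lambda>_. id)" by (auto simp: fun_eq_iff th2)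
      then show "(tpow_map ?tl \<circ> tpow_map ?tl) t = id t"
        using tpow_map_map[of ?tl ?tl t] by (simp add: alg_homD[OF th] clinear_id tpow_map_id)
    qed
    then show ?thesis
      by (simp add: assms(8) theta_left_def mer_map_map[OF tl tl] mer_map_id)
  qed
  have half: "(1/2) *\<^sub>C (y + y) = y" for y :: "('v, ('u, 2) tpow) mer_fun"
    by (simp add: scaleC_add_right scaleC_add_left[symmetric] scaleC_one)
  have r: "r = rp - rm" and rt: "rt = rp + rm"
    using half[of r] half[of rt]
    by (simp_all add: assms(10,11) cvec.scale_right_diff_distrib[symmetric] scaleC_add_right[symmetric])
  note tlin = lin[unfolded clinear_iff] clinear_diff[OF lin]
  have trt: "theta_left \<theta> r = rt" by (simp add: assms(8))
  \<comment> \<open>\<theta> on the first component exchanges \<open>r\<close> and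
    \<open>rt\<close>, so \<open>rp\<close> is even and \<open>rm\<close> is odd.\<close>
  have trp: "theta_left \<theta> rp = rp" by (simp add: assms(10) tlin trt inv add.commute)
  have trm: "theta_left \<theta> rm = - rm"
    by (simp only: assms(11) tlin trt inv minus_diff_eq cvec.scale_minus_right[symmetric])

  \<comment> \<open>The flip turns \<theta> on the second component of \<open>rt\<close> into
    \<theta> on the first; since \<open>rt\<close> is flip invariant, \<open>inv\<close> then gives
    \<open>r\<close>.\<close>
  have sym: "legs 2 1 (mer_map (tpow_map (\<lambda>_. \<theta>)) r) = r"
  proof -
    let ?tr = "\<lambda>k :: 2. if k = 1 then id else \<theta>"
    have tr: "clinear (tpow_map ?tr)"
      by (rule tpow_map_pure(2)) (simp add: alg_homD[OF th] clinear_id)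
    have "tpow_map ?tr \<circ> tpow_map ?tl = (tpow_map (\<lambda>_. \<theta>) :: ('u, 2) tpow \<Rightarrow> _)"
    proof
      fix t :: "('u, 2) tpow"
      have "(\<lambda>i. ?tr i \<circ> ?tl i) = (\<lambda>_. \<theta>)" by (auto simp: fun_eq_iff)
      then show "(tpow_map ?tr \<circ> tpow_map ?tl) t = tpow_map (\<lambda>_. \<theta>) t"
        using tpow_map_map[of ?tr ?tl t] by (simp add: alg_homD[OF th] clinear_id)
    qed
    then have "mer_map (tpow_map (\<lambda>_. \<theta>)) r = mer_map (tpow_map ?tr) rt"
      unfolding assms(8) theta_left_def mer_map_map[OF tr tl] by simp
    also have "legs 2 1 \<dots> = twist ?tl id (legs 2 1 rt)"
      by (subst twist_legs) (simp_all add: th alg_hom_id)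
    also have "\<dots> = r"
      by (simp add: assms(9) twist_perm_id theta_left_def[symmetric] inv)
    finally show ?thesis .
  qed
  have flip: "legs j i (mer_map (tpow_map (\<lambda>_. \<theta>)) r) = legs i j r" if "i \<noteq> j" for i j :: 3
    using legs_legs[OF that, of "mer_map (tpow_map (\<lambda>_. \<theta>)) r"] by (simp add: sym)

  \<comment> \<open>\<open>?S\<close> applies \<theta> to leg 1; \<open>?T\<close> swaps legs 1 and
    2, then applies \<theta> to both.\<close>
  let ?G = "\<lambda>m :: 3. if m = 1 then \<theta> else id" and ?H = "\<lambda>m :: 3. if m = 3 then id else \<theta>"
  let ?\<pi> = "\<lambda>m :: 3. if m = 1 then 2 else if m = 2 then 1 else m"
  let ?S = "twist ?G id :: ('v, ('u, 3) tpow) mer_fun \<Rightarrow> _"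
    and ?T = "twist ?H ?\<pi> :: ('v, ('u, 3) tpow) mer_fun \<Rightarrow> _"
  have G: "alg_hom (?G m)" and H: "alg_hom (?H m)" for m
    by (simp_all add: th alg_hom_id)
  have \<pi>: "inj ?\<pi>"
    by (rule injI) (auto split: if_splits)
  have S_legs: "?S (legs 1 2 f) = legs 1 2 (theta_left \<theta> f)" "?S (legs 1 3 f) = legs 1 3 (theta_left \<theta> f)"
    "?S (legs 2 3 f) = legs 2 3 f" for f
    by (simp_all add: twist_legs[where g = ?G, OF G] mtl mid)
  have S_E: "?S (dyn_E d x lam 1 f) = - dyn_E d x lam 1 (?S f)" "?S (dyn_E d x lam 2 f) = dyn_E d x lam 2 (?S f)"
    "?S (dyn_E d x lam 3 f) = dyn_E d x lam 3 (?S f)" for f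
    using twist_dyn_E_neg[where g = ?G, OF G inj_on_id, where i = 1 and x = x and d = d]
      twist_dyn_E[where g = ?G, OF G inj_on_id, where i = 2 and x = x and d = d]
      twist_dyn_E[where g = ?G, OF G inj_on_id, where i = 3 and x = x and d = d] thx by simp_all
  \<comment> \<open>In the first equation both components are twisted and \<open>flip\<close> undoes
    the reversed order. In the others \<theta> meets the first component only, which gives
    \<open>rt\<close>.\<close>
  have T_legs: "?T (legs 1 2 r) = legs 1 2 r" "?T (legs 1 3 r) = legs 2 3 rt" "?T (legs 2 3 r) = legs 1 3 rt"
    by (simp_all add: twist_legs[where g = ?H, OF H \<pi>] mtl trt flip)
  have T_E: "?T (dyn_E d x lam 1 f) = - dyn_E d x lam 2 (?T f)" "?T (dyn_E d x lam 2 f) = - dyn_E d x lam 1 (?T f)"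
    "?T (dyn_E d x lam 3 f) = dyn_E d x lam 3 (?T f)" for f
    using twist_dyn_E_neg[where g = ?H, OF H \<pi>, where i = 1 and x = x and d = d]
      twist_dyn_E_neg[where g = ?H, OF H \<pi>, where i = 2 and x = x and d = d]
      twist_dyn_E[where g = ?H, OF H \<pi>, where i = 3 and x = x and d = d] thx by simp_all
  have add: "f (a + b) = f a + f b" and diff: "f (a - b) = f a - f b" and neg: "f (- a) = - f a"
    if "clinear f" for f :: "'a::complex_vector \<Rightarrow> 'b::complex_vector" and a b
    using that by (simp_all add: clinear_iff[of f] clinear_diff clinear_minus)
  have SL: "clinear ?S" by (rule clinear_twist[where g = ?G, OF G]) simp
  have TL: "clinear ?T" by (rule clinear_twist[where g = ?H, OF H \<pi>])
  note lins = add[OF clinear_legs] diff[OF clinear_legs] neg[OF clinear_legs]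
    add[OF clinear_dyn_E] diff[OF clinear_dyn_E] neg[OF clinear_dyn_E]

  \<comment> \<open>Decomposition of the Yang-Baxter expression by parity\<close>
  let ?Y = "YB d x lam r" and ?C = "CYB rp rm"
    and ?C1 = "CYB1 d x lam rp rm" and ?C2 = "CYB2 d x lam rp rm" and ?C3 = "CYB3 d x lam rp rm"
  \<comment> \<open>Each of the three brackets in \<open>r = rp - rm\<close> expands into four
    terms, one for each of \<open>?C1\<close>, \<open>?C2\<close>, \<open>?C3\<close>,
    \<open>?C\<close>.\<close>
  have sum: "?Y = ?C1 - ?C2 + ?C3 + ?C"
    by (simp add: YB_def CYB_def CYB1_def CYB2_def CYB3_def r lins commutator_def algebra_simps)
  \<comment> \<open>On equal legs \<open>r + rt\<close> is \<open>2 rp\<close>. As \<open>?T\<close>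
    reverses the bracket on legs 13 and 23, only its mixed terms in \<open>rp\<close> and
    \<open>rm\<close> survive.\<close>
  have average: "?Y + ?T ?Y = (?C1 - ?C2) + (?C1 - ?C2)"
  proof -
    have "?T ?Y = commutator (legs 1 2 r) (legs 2 3 rt) + commutator (legs 1 2 r) (legs 1 3 rt)
        + commutator (legs 2 3 rt) (legs 1 3 rt)
        - dyn_E d x lam 2 (legs 1 3 rt) + dyn_E d x lam 1 (legs 2 3 rt) + dyn_E d x lam 3 (legs 1 2 r)"
      by (simp add: YB_def add[OF TL] diff[OF TL] twist_commutator[where g = ?H, OF H \<pi>] T_legs T_E)
    then show ?thesis
      by (simp add: YB_def CYB1_def CYB2_def r rt lins commutator_def algebra_simps)
  qed
  have even: "?S ?C1 = ?C1" "?S ?C = ?C" and odd: "?S ?C2 = - ?C2" "?S ?C3 = - ?C3"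
    by (simp_all add: CYB_def CYB1_def CYB2_def CYB3_def add[OF SL] diff[OF SL] neg[OF SL]
        twist_commutator[where g = ?G, OF G] S_legs S_E trp trm lins) (simp_all add: commutator_def algebra_simps)
  \<comment> \<open>The eigenspaces of \<open>?S\<close> for 1 and -1 meet only in 0.\<close>
  have split: "a = 0 \<and> b = 0" if "a = b" "?S a = a" "?S b = - b" for a b
  proof -
    have "b = - b" using that by metis
    then show ?thesis using add_self_eq_0_iff[of b] that(1) by (simp only: eq_neg_iff_add_eq_0)
  qed

  have "?C1 = 0 \<and> ?C2 = 0 \<and> ?C3 = 0 \<and> ?C = 0" if Y: "?Y = 0"
  proof -
    have "?C1 - ?C2 = 0"
      by (rule iffD1[OF add_self_eq_0_iff], fold average)
        (simp only: Y clinear_zero[OF TL] add_0_left)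
    then have 12: "?C1 = 0 \<and> ?C2 = 0"
      using split[OF _ even(1) odd(1)] by (simp only: right_minus_eq)
    then have "?C = - ?C3"
      using sum Y by (simp add: eq_neg_iff_add_eq_0 add.commute)
    \<comment> \<open>With \<open>?C1\<close> and \<open>?C2\<close> gone, \<open>sum\<close>
      equates the even \<open>?C\<close> with the odd \<open>- ?C3\<close>.\<close>
    then have "?C = 0 \<and> - ?C3 = 0"
      by (rule split[OF _ even(2)]) (simp only: neg[OF SL] odd)
    with 12 show ?thesis by simp
  qed
  with sum show ?thesis
    by (auto simp: dynamical_r_matrix_def dynamical_r_matrix_pair_def)
qed

end
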